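(* Let $d \geq 1$ and $n \geq d+1$ be integers, and let $\Sigma \subset \mathbb{R}^n$ be a $d$-dimensional $C^1$-embedded submanifold. Define $$ \mathscr{A}(\Sigma) := \Big\{ a \in \mathbb{R}^n : \mathrm{volume}\,\big\{ p \in \Sigma : \partial \mathbb{B}(a, |a-p|) \text{ is not transverse to } \Sigma \text{ at } p \big\} > 0 \Big\}. $$ Then $\mathscr{A}(\Sigma)$ is contained in a countable union of $(n-d-1)$-dimensional affine planes of $\mathbb{R}^n$.
   Context: $\mathbb{B}(a,\rho)$ denotes the Euclidean ball in $\mathbb{R}^n$ with centre $a$ and radius $\rho$, and $\partial\mathbb{B}(a,\rho)$ is its boundary sphere. "Volume" is the $d$-dimensional volume measure on $\Sigma$ with respect to the Riemannian metric induced by the embedding $\Sigma \hookrightarrow \mathbb{R}^n$ (equivalently, the $d$-dimensional Hausdorff measure $\mathcal{H}^d$ restricted to $\Sigma$). Two embedded $C^1$-submanifolds $\Sigma, \hat\Sigma \subset \mathbb{R}^n$ are transverse at a point $p \in \Sigma \cap \hat\Sigma$ if $T_p\Sigma + T_p\hat\Sigma = T_p\mathbb{R}^n$. Thus, for $p \in \Sigma$ with $p \neq a$, the sphere $\partial\mathbb{B}(a,|a-p|)$ (which passes through $p$) is not transverse to $\Sigma$ at $p$ exactly when $T_p\Sigma + T_p\partial\mathbb{B}(a,|a-p|) \neq \mathbb{R}^n$. The degenerate case $p = a$ concerns a single point, which has volume zero in $\Sigma$ because $d \geq 1$, so the convention adopted for it does not affect $\mathscr{A}(\Sigma)$. A $k$-dimensional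 affine plane is a translate of a $k$-dimensional linear subspace of $\mathbb{R}^n$; a $0$-dimensional affine plane is a point. *)

theory Defs
  imports "HOL-Analysis.Analysis"
begin

definition C1_map_on :: "'a::real_normed_vector set \<Rightarrow> ('a \<Rightarrow> 'b::real_normed_vector) \<Rightarrow> bool" where
  "C1_map_on U f \<longleftrightarrow>
    (\<exists>f' :: 'a \<Rightarrow> 'a \<Rightarrow>\<^sub>L 'b.
      (\<forall>x\<in>U. (f has_derivative blinfun_apply (f' x)) (at x)) \<and> continuous_on U f')"

text \<open>
  Embedded submanifolds are given by slice charts: near each of its points, a local
  \<open>C\<^sup>1\<close> diffeomorphism \<open>\<Phi>\<close> of the ambient space (with inverse \<open>\<Psi>\<close>) flattens \<open>M\<close> onto
  a relatively open part of a \<open>d\<close>-dimensional linear subspace \<open>S\<close>. Letting \<open>S\<close> vary,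
  instead of fixing a coordinate subspace, only absorbs a linear change of coordinates
  into \<open>\<Phi>\<close>. There is no boundary, and \<open>M\<close> need not be closed, connected or nonempty.
\<close>

definition C1_submanifold :: "nat \<Rightarrow> 'a::euclidean_space set \<Rightarrow> bool" where
  "C1_submanifold d M \<longleftrightarrow>
    (\<forall>p\<in>M. \<exists>(U :: 'a set) (V :: 'a set) \<Phi> \<Psi> (S :: 'a set).
      open U \<and> p \<in> U \<and> open V \<and> homeomorphism U V \<Phi> \<Psi> \<and>
      C1_map_on U \<Phi> \<and> C1_map_on V \<Psi> \<and>
      subspace S \<and> dim S = d \<and> \<Phi> ` (U \<inter> M) = V \<inter> S)"

text \<open>
  The tangent space is the set of velocities of \<open>C\<^sup>1\<close> curves in \<open>M\<close> through \<open>p\<close>. It is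
  used for points of a submanifold; for a degenerate sphere \<open>{p}\<close> it is \<open>{0}\<close>.
\<close>

definition tangent_space :: "'a::euclidean_space set \<Rightarrow> 'a \<Rightarrow> 'a set" where
  "tangent_space M p =
    {v. \<exists>(\<gamma> :: real \<Rightarrow> 'a) \<epsilon>. \<epsilon> > 0 \<and> \<gamma> C1_differentiable_on {-\<epsilon><..<\<epsilon>} \<and>
        \<gamma> ` {-\<epsilon><..<\<epsilon>} \<subseteq> M \<and> \<gamma> 0 = p \<and> (\<gamma> has_vector_derivative v) (at 0)}"

definition transverse_at :: "'a::euclidean_space set \<Rightarrow> 'a set \<Rightarrow> 'a \<Rightarrow> bool" where
  "transverse_at M N p \<longleftrightarrow> {u + v |u v. u \<in> tangent_space M p \<and> v \<in> tangent_space N p} = UNIV"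

text \<open>
  The \<open>d\<close>-dimensional Hausdorff (outer) measure, normalised so that it agrees with Lebesgue
  measure on \<open>d\<close>-dimensional Euclidean space; on a \<open>d\<close>-dimensional \<open>C\<^sup>1\<close> submanifold it is
  the Riemannian volume of the induced metric. Boundedness of the covering sets must be
  required because \<^const>\<open>diameter\<close> is unspecified on unbounded sets, and empty covering
  sets are made to contribute nothing also when \<open>d = 0\<close>, where \<open>0 ^ 0 = 1\<close>.
\<close>

definition hausdorff_content :: "nat \<Rightarrow> real \<Rightarrow> 'a::metric_space set \<Rightarrow> ennreal" where
  "hausdorff_content d \<delta> A =
    (INF C \<in> {C :: nat \<Rightarrow> 'a set. A \<subseteq> (\<Union>i. C i) \<and> (\<forall>i. bounded (C i) \<and> diameter (C i) \<le> \<delta>)}.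
      \<Sum>i. if C i = {} then 0
          else ennreal (unit_ball_vol (real d) * (diameter (C i) / 2) ^ d))"

definition hausdorff_measure :: "nat \<Rightarrow> 'a::metric_space set \<Rightarrow> ennreal" where
  "hausdorff_measure d A = (SUP \<delta> \<in> {0<..}. hausdorff_content d \<delta> A)"

definition nontransverse_points :: "'a::euclidean_space set \<Rightarrow> 'a \<Rightarrow> 'a set" where
  "nontransverse_points M a = {p \<in> M. \<not> transverse_at (sphere a (dist a p)) M p}"

definition exceptional_centres :: "nat \<Rightarrow> 'a::euclidean_space set \<Rightarrow> 'a set" where
  "exceptional_centres d M = {a. hausdorff_measure d (nontransverse_points M a) > 0}"

end

theory Submission
  imports Defs
begin

text \<open>
  If the sphere about \<open>a\<close> is not transverse to \<open>\<Sigma>\<close> at \<open>p\<close>, then \<open>a\<close> lies in the affine normal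
  space of \<open>\<Sigma>\<close> at \<open>p\<close>, which has dimension \<open>m = n - d\<close>. Hence \<open>m + 1\<close> affinely independent centres
  determine that normal space, and their common nontransverse points are isolated on it, so they
  form a null set. On a patch of finite volume, \<open>N\<close> centres in general position whose
  nontransverse sets have volume at least \<open>\<epsilon>\<close> therefore satisfy \<open>N \<epsilon> \<le> m vol\<close>. If the centres of
  this kind were not covered by finitely many \<open>(m - 1)\<close>-planes, arbitrarily many of them in general
  position could be picked greedily. Countably many patches and values of \<open>\<epsilon>\<close> suffice.
\<close>

subsection \<open>Hausdorff measure\<close>

definition hausdorff_weight :: "nat \<Rightarrow> 'a::metric_space set \<Rightarrow> ennreal" where
  "hausdorff_weight d C =
    (if C = {} then 0 else ennreal (unit_ball_vol (real d) * (diameter C / 2) ^ d))"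

lemma hausdorff_weight_empty [simp]: "hausdorff_weight d {} = 0"
  by (simp add: hausdorff_weight_def)

lemma hausdorff_weight_le:
  assumes "bounded C" "diameter C \<le> r"
  shows "hausdorff_weight d C \<le> ennreal (unit_ball_vol (real d) * (r / 2) ^ d)"
  using assms diameter_ge_0[OF assms(1)]
  by (auto simp: hausdorff_weight_def intro!: ennreal_leI mult_left_mono power_mono)

lemma hausdorff_weight_mono:
  assumes "A \<subseteq> B" "bounded B"
  shows "hausdorff_weight d A \<le> hausdorff_weight d B"
proof (cases "A = {}")
  case False
  then have "B \<noteq> {}" using assms by auto
  then show ?thesis
    using hausdorff_weight_le[of A "diameter B" d] diameter_subset[OF assms]
      bounded_subset[OF assms(2,1)]
    by (simp add: hausdorff_weight_def)
qed auto

definition hausdorff_cover :: "real \<Rightarrow> 'a::metric_space set \<Rightarrow> (nat \<Rightarrow> 'a set) \<Rightarrow> bool" where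
  "hausdorff_cover \<delta> A C \<longleftrightarrow> A \<subseteq> (\<Union>i. C i) \<and> (\<forall>i. bounded (C i) \<and> diameter (C i) \<le> \<delta>)"

lemma hausdorff_content_eq:
  "hausdorff_content d \<delta> A = (INF C \<in> Collect (hausdorff_cover \<delta> A). \<Sum>i. hausdorff_weight d (C i))"
  unfolding hausdorff_content_def hausdorff_weight_def hausdorff_cover_def ..

lemma hausdorff_content_le:
  assumes "hausdorff_cover \<delta> A C"
  shows "hausdorff_content d \<delta> A \<le> (\<Sum>i. hausdorff_weight d (C i))"
  unfolding hausdorff_content_eq by (rule INF_lower) (simp add: assms)

lemma hausdorff_content_greatest:
  assumes "\<And>C. hausdorff_cover \<delta> A C \<Longrightarrow> z \<le> (\<Sum>i. hausdorff_weight d (C i))"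
  shows "z \<le> hausdorff_content d \<delta> A"
  unfolding hausdorff_content_eq by (rule INF_greatest) (simp add: assms)

lemma hausdorff_content_mono:
  assumes "A \<subseteq> B"
  shows "hausdorff_content d \<delta> A \<le> hausdorff_content d \<delta> B"
  by (rule hausdorff_content_greatest, rule hausdorff_content_le)
    (use assms in \<open>auto simp: hausdorff_cover_def\<close>)

lemma hausdorff_content_antimono:
  assumes "\<delta> \<le> \<delta>'"
  shows "hausdorff_content d \<delta>' A \<le> hausdorff_content d \<delta> A"
  by (rule hausdorff_content_greatest, rule hausdorff_content_le)
    (use assms in \<open>auto simp: hausdorff_cover_def intro: order_trans\<close>)

text \<open>The content is defined by sequences, so the finite cover is enumerated and padded with
  empty sets. These have weight 0, and \<open>0 < \<delta>\<close> makes them admissible.\<close>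

lemma hausdorff_content_finite_cover:
  fixes C :: "'i \<Rightarrow> 'a::metric_space set"
  assumes "finite I" "A \<subseteq> (\<Union>i\<in>I. C i)" "0 < \<delta>"
    and C: "\<And>i. i \<in> I \<Longrightarrow> bounded (C i) \<and> diameter (C i) \<le> \<delta>"
  shows "hausdorff_content d \<delta> A \<le> (\<Sum>i\<in>I. hausdorff_weight d (C i))"
proof -
  from ex_bij_betw_nat_finite[OF \<open>finite I\<close>]
  obtain h where h: "bij_betw h {0..<card I} I" ..
  define D where "D k = (if k < card I then C (h k) else {})" for k
  have hI: "h k \<in> I" if "k < card I" for k
    using h that by (auto simp: bij_betw_def)
  have "hausdorff_cover \<delta> A D"
    unfolding hausdorff_cover_def
  proof (intro conjI allI)
    show "A \<subseteq> (\<Union>i. D i)"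
    proof
      fix x assume "x \<in> A"
      then obtain i where i: "i \<in> I" "x \<in> C i" using assms by auto
      then have "i \<in> h ` {0..<card I}" using h by (simp add: bij_betw_def)
      then obtain k where "k < card I" "h k = i" by auto
      then have "x \<in> D k" using i by (simp add: D_def)
      then show "x \<in> (\<Union>i. D i)" by auto
    qed
  qed (use C hI \<open>0 < \<delta>\<close> in \<open>auto simp: D_def\<close>)
  then have "hausdorff_content d \<delta> A \<le> (\<Sum>k. hausdorff_weight d (D k))"
    by (rule hausdorff_content_le)
  also have "\<dots> = (\<Sum>k\<in>{0..<card I}. hausdorff_weight d (D k))"
    by (rule suminf_finite) (auto simp: D_def)
  also have "\<dots> = (\<Sum>k\<in>{0..<card I}. hausdorff_weight d (C (h k)))"
    by (rule sum.cong) (auto simp: D_def)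
  also have "\<dots> = (\<Sum>i\<in>I. hausdorff_weight d (C i))"
    by (rule sum.reindex_bij_betw[OF h])
  finally show ?thesis .
qed

text \<open>Each \<open>A n\<close> gets a cover that is optimal up to
  \<open>e / 2 ^ (n + 1)\<close>; \<open>prod_decode\<close> merges all of them into one sequence,
  and the errors add up to \<open>e\<close>.\<close>

lemma hausdorff_content_countably_subadditive:
  "hausdorff_content d \<delta> (\<Union>i. A i) \<le> (\<Sum>i. hausdorff_content d \<delta> (A i))"
proof (rule ennreal_le_epsilon)
  fix e :: real assume fin: "(\<Sum>i. hausdorff_content d \<delta> (A i)) < top" and "0 < e"
  have "\<exists>C. hausdorff_cover \<delta> (A n) C \<and> (\<Sum>i. hausdorff_weight d (C i))
      \<le> hausdorff_content d \<delta> (A n) + ennreal e * ennreal ((1/2) ^ Suc n)" for n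
  proof -
    \<comment> \<open>Finiteness makes the addition of a positive amount a strict increase, so a
      cover below the increased value exists.\<close>
    have "hausdorff_content d \<delta> (A n) < top"
      using fin by (rule ennreal_suminf_lessD)
    then have "hausdorff_content d \<delta> (A n)
        < hausdorff_content d \<delta> (A n) + ennreal e * ennreal ((1/2) ^ Suc n)"
      using \<open>0 < e\<close> by (simp add: ennreal_zero_less_mult_iff)
    then show ?thesis
      using hausdorff_content_greatest[of \<delta> "A n" "hausdorff_content d \<delta> (A n) + ennreal e * ennreal ((1/2) ^ Suc n)" d]
      by (meson linorder_not_le nle_le)
  qed
  then obtain C where C: "\<And>n. hausdorff_cover \<delta> (A n) (C n)"
    and le: "\<And>n. (\<Sum>i. hausdorff_weight d (C n i))
      \<le> hausdorff_content d \<delta> (A n) + ennreal e * ennreal ((1/2) ^ Suc n)"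
    by metis
  define D where "D = (\<lambda>k. case prod_decode k of (n, i) \<Rightarrow> C n i)"
  have "hausdorff_cover \<delta> (\<Union>i. A i) D"
    unfolding hausdorff_cover_def
  proof (intro conjI allI)
    show "(\<Union>i. A i) \<subseteq> (\<Union>i. D i)"
    proof
      fix x assume "x \<in> (\<Union>i. A i)"
      then obtain n where "x \<in> A n" by auto
      then obtain i where "x \<in> C n i" using C[of n] by (auto simp: hausdorff_cover_def)
      then have "x \<in> D (prod_encode (n, i))" by (simp add: D_def)
      then show "x \<in> (\<Union>i. D i)" by blast
    qed
  qed (use C in \<open>auto simp: D_def hausdorff_cover_def split: prod.split\<close>)
  then have "hausdorff_content d \<delta> (\<Union>i. A i) \<le> (\<Sum>i. hausdorff_weight d (D i))"
    by (rule hausdorff_content_le)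
  also have "\<dots> = (\<Sum>k. (\<lambda>(n, i). hausdorff_weight d (C n i)) (prod_decode k))"
    by (simp add: D_def case_prod_unfold)
  also have "\<dots> = (\<Sum>n. \<Sum>i. hausdorff_weight d (C n i))"
    by (rule suminf_ennreal_2dimen) simp
  also have "\<dots> \<le> (\<Sum>n. hausdorff_content d \<delta> (A n) + ennreal e * ennreal ((1/2) ^ Suc n))"
    by (intro suminf_le le) auto
  also have "\<dots> = (\<Sum>n. hausdorff_content d \<delta> (A n)) + (\<Sum>n. ennreal e * ennreal ((1/2) ^ Suc n))"
    by (rule suminf_add[symmetric]) auto
  also have "(\<Sum>n. ennreal e * ennreal ((1/2) ^ Suc n)) = ennreal e * (\<Sum>n. ennreal ((1/2) ^ Suc n))"
    by (rule ennreal_suminf_cmult)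
  also have "(\<Sum>n. ennreal ((1/2) ^ Suc n)) = ennreal 1"
    using power_half_series by (intro suminf_ennreal_eq) auto
  finally show "hausdorff_content d \<delta> (\<Union>i. A i)
      \<le> (\<Sum>i. hausdorff_content d \<delta> (A i)) + ennreal e" by simp
qed

lemma hausdorff_content_le_measure:
  "0 < \<delta> \<Longrightarrow> hausdorff_content d \<delta> A \<le> hausdorff_measure d A"
  unfolding hausdorff_measure_def by (rule SUP_upper) simp

lemma hausdorff_measure_least:
  assumes "\<And>\<delta>. 0 < \<delta> \<Longrightarrow> hausdorff_content d \<delta> A \<le> z"
  shows "hausdorff_measure d A \<le> z"
  unfolding hausdorff_measure_def by (rule SUP_least) (simp add: assms)

lemma hausdorff_measure_mono:
  "A \<subseteq> B \<Longrightarrow> hausdorff_measure d A \<le> hausdorff_measure d B"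
  by (meson hausdorff_content_le_measure hausdorff_content_mono hausdorff_measure_least order_trans)

lemma hausdorff_measure_empty [simp]: "hausdorff_measure d {} = 0"
proof -
  have "hausdorff_measure d ({} :: 'a set) \<le> 0"
  proof (rule hausdorff_measure_least)
    fix \<delta> :: real assume "0 < \<delta>"
    then have "hausdorff_content d \<delta> ({} :: 'a set) \<le> (\<Sum>i::nat\<in>{}. hausdorff_weight d ({} :: 'a set))"
      by (intro hausdorff_content_finite_cover) auto
    then show "hausdorff_content d \<delta> ({} :: 'a set) \<le> 0" by simp
  qed
  then show ?thesis by simp
qed

lemma hausdorff_measure_countably_subadditive:
  "hausdorff_measure d (\<Union>i. A i) \<le> (\<Sum>i. hausdorff_measure d (A i))"
proof (rule hausdorff_measure_least)
  fix \<delta> :: real assume "0 < \<delta>"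
  have "hausdorff_content d \<delta> (\<Union>i. A i) \<le> (\<Sum>i. hausdorff_content d \<delta> (A i))"
    by (rule hausdorff_content_countably_subadditive)
  also have "\<dots> \<le> (\<Sum>i. hausdorff_measure d (A i))"
    by (intro suminf_le hausdorff_content_le_measure \<open>0 < \<delta>\<close>) auto
  finally show "hausdorff_content d \<delta> (\<Union>i. A i) \<le> (\<Sum>i. hausdorff_measure d (A i))" .
qed

lemma outer_measure_space_hausdorff: "outer_measure_space UNIV (hausdorff_measure d)"
  unfolding outer_measure_space_def positive_def increasing_def countably_subadditive_def
  by (auto simp: hausdorff_measure_mono intro: hausdorff_measure_countably_subadditive)

lemma hausdorff_measure_Un_le:
  "hausdorff_measure d (A \<union> B) \<le> hausdorff_measure d A + hausdorff_measure d B"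
proof -
  have "hausdorff_measure d (\<Union>i. if i = 0 then A else if i = Suc 0 then B else {})
      \<le> (\<Sum>i. hausdorff_measure d (if i = 0 then A else if i = Suc 0 then B else {}))"
    by (rule hausdorff_measure_countably_subadditive)
  also have "\<dots> = (\<Sum>i\<in>{0, Suc 0}. hausdorff_measure d (if i = 0 then A else if i = Suc 0 then B else {}))"
    by (rule suminf_finite) auto
  also have "(\<Union>i. if i = 0 then A else if i = Suc 0 then B else {}) = A \<union> B"
    by (auto split: if_splits)
  finally show ?thesis by simp
qed

lemma hausdorff_measure_countable_UN_null:
  assumes "countable I" "\<And>i. i \<in> I \<Longrightarrow> hausdorff_measure d (A i) = 0"
  shows "hausdorff_measure d (\<Union>i\<in>I. A i) = 0"
proof (cases "I = {}")
  case False
  have "hausdorff_measure d (\<Union>k. A (from_nat_into I k))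
      \<le> (\<Sum>k. hausdorff_measure d (A (from_nat_into I k)))"
    by (rule hausdorff_measure_countably_subadditive)
  also have "\<dots> = 0" using assms(2) from_nat_into[OF False] by simp
  also have "(\<Union>k. A (from_nat_into I k)) = (\<Union>i\<in>I. A i)"
    using range_from_nat_into[OF False assms(1)] by (simp flip: image_image)
  finally show ?thesis by simp
qed auto

text \<open>The set is covered by its singletons, which have diameter 0; \<open>1 \<le> d\<close>
  makes \<open>0 ^ d\<close> vanish.\<close>

lemma hausdorff_measure_finite_null:
  assumes "finite A" "1 \<le> d"
  shows "hausdorff_measure d A = 0"
proof -
  have "hausdorff_measure d A \<le> 0"
  proof (rule hausdorff_measure_least)
    fix \<delta> :: real assume "0 < \<delta>"
    then have "hausdorff_content d \<delta> A \<le> (\<Sum>x\<in>A. hausdorff_weight d {x})"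
      using assms(1) by (intro hausdorff_content_finite_cover) auto
    also have "\<dots> = 0" using assms(2) by (simp add: hausdorff_weight_def)
    finally show "hausdorff_content d \<delta> A \<le> 0" .
  qed
  then show ?thesis by simp
qed

text \<open>A covering set of diameter less than \<open>\<epsilon>\<close> cannot meet both
  \<open>A\<close> and \<open>B\<close>, so a fine cover of the union splits into separate covers of
  \<open>A\<close> and of \<open>B\<close>.\<close>

lemma hausdorff_measure_metric_additive:
  assumes "0 < \<epsilon>" and sep: "\<And>x y. x \<in> A \<Longrightarrow> y \<in> B \<Longrightarrow> \<epsilon> \<le> dist x y"
  shows "hausdorff_measure d A + hausdorff_measure d B \<le> hausdorff_measure d (A \<union> B)"
proof -
  have small: "hausdorff_content d \<delta> A + hausdorff_content d \<delta> B \<le> hausdorff_content d \<delta> (A \<union> B)"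
    if "0 < \<delta>" "\<delta> < \<epsilon>" for \<delta>
  proof (rule hausdorff_content_greatest)
    fix C assume C: "hausdorff_cover \<delta> (A \<union> B) C"
    then have bd: "bounded (C i)" "diameter (C i) \<le> \<delta>" for i
      by (auto simp: hausdorff_cover_def)
    have cov: "hausdorff_cover \<delta> D (\<lambda>i. C i \<inter> D)" if "D \<subseteq> A \<union> B" for D
      unfolding hausdorff_cover_def
    proof (intro conjI allI)
      show "D \<subseteq> (\<Union>i. C i \<inter> D)" using C that by (auto simp: hausdorff_cover_def)
      show "bounded (C i \<inter> D)" for i using bd(1)[of i] by (simp add: bounded_Int)
      show "diameter (C i \<inter> D) \<le> \<delta>" for i
        using diameter_subset[of "C i \<inter> D" "C i"] bd[of i] by simp
    qed
    have "hausdorff_weight d (C i \<inter> A) + hausdorff_weight d (C i \<inter> B) \<le> hausdorff_weight d (C i)" for i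
    proof -
      have "C i \<inter> A = {} \<or> C i \<inter> B = {}"
      proof (rule ccontr)
        assume "\<not> ?thesis"
        then obtain x y where "x \<in> C i" "x \<in> A" "y \<in> C i" "y \<in> B" by auto
        then have "\<epsilon> \<le> diameter (C i)"
          using sep diameter_bounded_bound[OF bd(1)[of i]] by (meson order_trans)
        with bd(2)[of i] that(2) show False by simp
      qed
      then show ?thesis
        using hausdorff_weight_mono[of "C i \<inter> A" "C i" d] hausdorff_weight_mono[of "C i \<inter> B" "C i" d] bd(1)[of i]
        by auto
    qed
    then have "(\<Sum>i. hausdorff_weight d (C i \<inter> A) + hausdorff_weight d (C i \<inter> B))
        \<le> (\<Sum>i. hausdorff_weight d (C i))"
      by (intro suminf_le) auto
    also have "(\<Sum>i. hausdorff_weight d (C i \<inter> A) + hausdorff_weight d (C i \<inter> B))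
        = (\<Sum>i. hausdorff_weight d (C i \<inter> A)) + (\<Sum>i. hausdorff_weight d (C i \<inter> B))"
      by (rule suminf_add[symmetric]) auto
    finally show "hausdorff_content d \<delta> A + hausdorff_content d \<delta> B
        \<le> (\<Sum>i. hausdorff_weight d (C i))"
      using hausdorff_content_le[OF cov[of A]] hausdorff_content_le[OF cov[of B]]
      by (meson Un_upper1 Un_upper2 add_mono order_trans)
  qed
  \<comment> \<open>The content grows as \<open>\<delta>\<close> shrinks, so the two suprema are
    directed and may be taken together.\<close>
  have "hausdorff_measure d A + hausdorff_measure d B
      = (SUP \<delta> \<in> {0<..}. hausdorff_content d \<delta> A + hausdorff_content d \<delta> B)"
    unfolding hausdorff_measure_def
  proof (rule SUP_add_directed_ennreal[symmetric])
    fix i j :: real assume "i \<in> {0<..}" "j \<in> {0<..}"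
    then show "\<exists>k\<in>{0<..}. hausdorff_content d i A + hausdorff_content d j B
        \<le> hausdorff_content d k A + hausdorff_content d k B"
      by (intro bexI[of _ "min i j"] add_mono hausdorff_content_antimono) auto
  qed
  also have "\<dots> \<le> hausdorff_measure d (A \<union> B)"
  proof (rule SUP_least)
    fix \<delta> :: real assume "\<delta> \<in> {0<..}"
    \<comment> \<open>The splitting needs a scale below \<open>\<epsilon>\<close>; shrinking
      \<open>\<delta>\<close> only increases the left-hand side.\<close>
    define \<delta>' where "\<delta>' = min \<delta> (\<epsilon> / 2)"
    have \<delta>': "0 < \<delta>'" "\<delta>' \<le> \<delta>" "\<delta>' < \<epsilon>" using \<open>\<delta> \<in> _\<close> \<open>0 < \<epsilon>\<close> by (auto simp: \<delta>'_def)
    have "hausdorff_content d \<delta> A + hausdorff_content d \<delta> B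
        \<le> hausdorff_content d \<delta>' A + hausdorff_content d \<delta>' B"
      by (intro add_mono hausdorff_content_antimono \<delta>')
    also have "\<dots> \<le> hausdorff_content d \<delta>' (A \<union> B)" by (intro small \<delta>')
    also have "\<dots> \<le> hausdorff_measure d (A \<union> B)" by (intro hausdorff_content_le_measure \<delta>')
    finally show "hausdorff_content d \<delta> A + hausdorff_content d \<delta> B \<le> hausdorff_measure d (A \<union> B)" .
  qed
  finally show ?thesis .
qed

subsection \<open>Borel sets and Lipschitz images\<close>

text \<open>Metric additivity is applied once for each new set. The gap between \<open>R k\<close>
  and the earlier sets may depend on \<open>k\<close>, which suits shells that accumulate at a
  closed set.\<close>

lemma hausdorff_measure_sum_le_UN:
  fixes n :: nat
  assumes sep: "\<And>k. \<exists>\<epsilon>>0. \<forall>i<k. \<forall>x\<in>R i. \<forall>y\<in>R k. \<epsilon> \<le> dist x y"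
  shows "(\<Sum>i<n. hausdorff_measure d (R i)) \<le> hausdorff_measure d (\<Union>i<n. R i)"
proof (induction n)
  case (Suc n)
  obtain \<epsilon> where "0 < \<epsilon>" and \<epsilon>: "\<And>i x y. i < n \<Longrightarrow> x \<in> R i \<Longrightarrow> y \<in> R n \<Longrightarrow> \<epsilon> \<le> dist x y"
    using sep[of n] by blast
  have "(\<Sum>i<Suc n. hausdorff_measure d (R i))
      \<le> hausdorff_measure d (\<Union>i<n. R i) + hausdorff_measure d (R n)"
    using Suc.IH by (simp add: add_right_mono)
  also have "\<dots> \<le> hausdorff_measure d ((\<Union>i<n. R i) \<union> R n)"
    by (rule hausdorff_measure_metric_additive[OF \<open>0 < \<epsilon>\<close>]) (use \<epsilon> in auto)
  also have "(\<Union>i<n. R i) \<union> R n = (\<Union>i<Suc n. R i)"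
    by (auto simp: lessThan_Suc)
  finally show ?case .
qed simp

lemma suminf_hausdorff_measure_le:
  assumes sep: "\<And>k. \<exists>\<epsilon>>0. \<forall>i<k. \<forall>x\<in>R i. \<forall>y\<in>R k. \<epsilon> \<le> dist x y"
    and "\<And>k. R k \<subseteq> X"
  shows "(\<Sum>i. hausdorff_measure d (R i)) \<le> hausdorff_measure d X"
proof (rule suminf_le_const)
  fix n
  have "(\<Sum>i<n. hausdorff_measure d (R i)) \<le> hausdorff_measure d (\<Union>i<n. R i)"
    by (rule hausdorff_measure_sum_le_UN[OF sep])
  also have "\<dots> \<le> hausdorff_measure d X"
    using assms(2) by (intro hausdorff_measure_mono) auto
  finally show "(\<Sum>i<n. hausdorff_measure d (R i)) \<le> hausdorff_measure d X" .
qed auto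

text \<open>Some partial sum comes within \<open>e\<close> of the finite total. Below, this discards
  the shells closest to the closed set.\<close>

lemma ennreal_suminf_tail_small:
  fixes g :: "nat \<Rightarrow> ennreal"
  assumes "suminf g < top" "0 < e"
  obtains m where "(\<Sum>i. g (i + m)) \<le> ennreal e"
proof -
  obtain r where r: "suminf g = ennreal r" "0 \<le> r"
    using assms(1) by (cases "suminf g") auto
  have "\<exists>m. (\<Sum>i<m. g i) + ennreal e \<ge> suminf g"
  proof (cases "r \<le> e")
    case True
    then show ?thesis using r by (intro exI[of _ 0]) (simp add: ennreal_leI)
  next
    case False
    then have "ennreal (r - e) < (SUP m. \<Sum>i<m. g i)"
      using r assms(2) by (simp flip: suminf_eq_SUP add: ennreal_less_iff)
    then obtain m where "ennreal (r - e) < (\<Sum>i<m. g i)"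
      by (auto simp: less_SUP_iff)
    then have "ennreal (r - e) + ennreal e \<le> (\<Sum>i<m. g i) + ennreal e"
      by (intro add_right_mono) simp
    then show ?thesis using r False assms(2) by (auto simp flip: ennreal_plus)
  qed
  then obtain m where m: "(\<Sum>i<m. g i) + ennreal e \<ge> suminf g" ..
  have split: "suminf g = (\<Sum>i<m. g i) + (\<Sum>i. g (i + m))"
    using suminf_offset[of g m] by (simp add: add.commute)
  \<comment> \<open>Cancelling the partial sum is valid in \<open>ennreal\<close> only because it is
    finite.\<close>
  have "(\<Sum>i<m. g i) \<noteq> top"
  proof
    assume "(\<Sum>i<m. g i) = top"
    then have "suminf g = top" using split by (metis ennreal_add_eq_top)
    with assms(1) show False by simp
  qed
  then have "(\<Sum>i. g (i + m)) \<le> ennreal e"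
    using m unfolding split ennreal_add_left_cancel_le infinity_ennreal_def by blast
  then show ?thesis by (rule that)
qed

text \<open>
  Caratheodory's criterion: a set \<open>X\<close> is exhausted away from \<open>F\<close> by the shells of points whose
  distance to \<open>F\<close> lies between \<open>1 / (k + 2)\<close> and \<open>1 / (k + 1)\<close>; shells of equal parity are
  separated, so their measures are summable.
\<close>

lemma hausdorff_measure_closed_split:
  fixes F :: "'a::metric_space set"
  assumes "closed F"
  shows "hausdorff_measure d (X \<inter> F) + hausdorff_measure d (X - F) \<le> hausdorff_measure d X"
proof (cases "F = {} \<or> hausdorff_measure d X = top")
  case False
  \<comment> \<open>\<open>infdist\<close> to the empty set is 0 by convention, so that case is set
    aside; finite measure will make the sum over the shells finite.\<close>
  then have "F \<noteq> {}" and fin: "hausdorff_measure d X < top" by (auto simp: less_top)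
  define R where "R k = {x \<in> X. 1 / (real k + 2) \<le> infdist x F \<and> infdist x F < 1 / (real k + 1)}" for k
  have sep: "\<exists>\<epsilon>>0. \<forall>i<k. \<forall>x\<in>R (2 * i + c). \<forall>y\<in>R (2 * k + c). \<epsilon> \<le> dist x y" for k c
  proof (cases "k = 0")
    case False
    \<comment> \<open>For \<open>i < k\<close> the shell \<open>R (2 * i + c)\<close> has distance
      at least \<open>1 / (2 * k + c)\<close> from \<open>F\<close>, while
      \<open>R (2 * k + c)\<close> stays closer than \<open>1 / (2 * k + c + 1)\<close>: the skipped
      shell of the other parity is the gap.\<close>
    define \<epsilon> where "\<epsilon> = 1 / real (2 * k + c) - 1 / (real (2 * k + c) + 1)"
    have "\<epsilon> > 0" using False by (simp add: \<epsilon>_def frac_less2)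
    moreover have "\<epsilon> \<le> dist x y" if "i < k" "x \<in> R (2 * i + c)" "y \<in> R (2 * k + c)" for i x y
    proof -
      have "1 / real (2 * k + c) \<le> 1 / (real (2 * i + c) + 2)"
        using that(1) by (intro divide_left_mono) auto
      also have "\<dots> \<le> infdist x F" using that(2) by (simp add: R_def)
      finally have "1 / real (2 * k + c) \<le> infdist x F" .
      moreover have "infdist y F < 1 / (real (2 * k + c) + 1)" using that(3) by (simp add: R_def)
      moreover have "infdist x F \<le> infdist y F + dist x y" by (rule infdist_triangle)
      ultimately show ?thesis by (simp add: \<epsilon>_def)
    qed
    ultimately show ?thesis by blast
  qed (auto intro: exI[of _ 1])
  \<comment> \<open>Neighbouring shells touch, so the even and the odd ones are bounded separately,
    at the cost of a factor 2.\<close>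
  define g where "g k = hausdorff_measure d (R (2 * k)) + hausdorff_measure d (R (2 * k + 1))" for k
  have "suminf g = (\<Sum>k. hausdorff_measure d (R (2 * k))) + (\<Sum>k. hausdorff_measure d (R (2 * k + 1)))"
    unfolding g_def by (rule suminf_add[symmetric]) auto
  also have "\<dots> \<le> hausdorff_measure d X + hausdorff_measure d X"
    using sep[of _ 0] sep[of _ 1]
    by (intro add_mono suminf_hausdorff_measure_le) (auto simp: R_def)
  also have "\<dots> < top" using fin by simp
  finally have gfin: "suminf g < top" .
  show ?thesis
  proof (rule ennreal_le_epsilon)
    fix e :: real assume "0 < e"
    obtain m where m: "(\<Sum>i. g (i + m)) \<le> ennreal e"
      using ennreal_suminf_tail_small[OF gfin \<open>0 < e\<close>] .
    \<comment> \<open>The threshold is the outer radius of the shell \<open>R (2 * m)\<close>, so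
      outside \<open>Y\<close> and \<open>F\<close> only shells of index at least
      \<open>2 * m\<close> remain.\<close>
    define Y where "Y = {x \<in> X. 1 / (2 * real m + 1) \<le> infdist x F}"
    have cover: "X - F \<subseteq> Y \<union> (\<Union>i. R (2 * (i + m)) \<union> R (2 * (i + m) + 1))"
    proof
      fix x assume x: "x \<in> X - F"
      define t where "t = infdist x F"
      have "t > 0" using x assms \<open>F \<noteq> {}\<close> infdist_pos_not_in_closed by (auto simp: t_def)
      show "x \<in> Y \<union> (\<Union>i. R (2 * (i + m)) \<union> R (2 * (i + m) + 1))"
      proof (cases "1 / (2 * real m + 1) \<le> t")
        case True then show ?thesis using x by (simp add: Y_def t_def)
      next
        case less: False
        obtain n where n: "1 / (real n + 1) < t"
          using reals_Archimedean[OF \<open>t > 0\<close>] by (auto simp: field_simps)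
        have "1 / (real n + 2) \<le> 1 / (real n + 1)" by (simp add: frac_le)
        with n have ex: "1 / (real n + 2) \<le> t" by simp
        \<comment> \<open>The shell containing \<open>x\<close>: minimality gives its outer bound,
          except for \<open>j = 0\<close>, where \<open>t < 1\<close> follows from \<open>x\<close>
          not being in \<open>Y\<close>.\<close>
        define j where "j = (LEAST j. 1 / (real j + 2) \<le> t)"
        have j: "1 / (real j + 2) \<le> t" unfolding j_def by (rule LeastI[of "\<lambda>j. 1 / (real j + 2) \<le> t", OF ex])
        have lt: "t < 1 / (real j + 1)"
        proof (cases j)
          case 0
          have "1 / (2 * real m + 1) \<le> 1" by simp
          with less have "t < 1" by linarith
          then show ?thesis using 0 by simp
        next
          case (Suc i)
          then have "\<not> 1 / (real i + 2) \<le> t" using not_less_Least[of i "\<lambda>j. 1 / (real j + 2) \<le> t"] by (simp add: j_def)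
          then show ?thesis using Suc by (simp add: add.commute)
        qed
        have "1 / (real j + 2) < 1 / (2 * real m + 1)" using j less by simp
        then have "2 * real m + 1 < real j + 2"
          by (simp add: field_simps)
        then have "2 * m \<le> j" by linarith
        then obtain i where "j = 2 * m + i" by (auto simp: le_iff_add)
        then have "j = 2 * (i div 2 + m) \<or> j = 2 * (i div 2 + m) + 1" by arith
        moreover have "x \<in> R j" using x j lt by (simp add: R_def t_def)
        ultimately show ?thesis by blast
      qed
    qed
    have "hausdorff_measure d (X - F)
        \<le> hausdorff_measure d Y + hausdorff_measure d (\<Union>i. R (2 * (i + m)) \<union> R (2 * (i + m) + 1))"
      using hausdorff_measure_mono[OF cover] hausdorff_measure_Un_le by (rule order_trans)
    also have "hausdorff_measure d (\<Union>i. R (2 * (i + m)) \<union> R (2 * (i + m) + 1))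
        \<le> (\<Sum>i. hausdorff_measure d (R (2 * (i + m)) \<union> R (2 * (i + m) + 1)))"
      by (rule hausdorff_measure_countably_subadditive)
    also have "\<dots> \<le> (\<Sum>i. g (i + m))"
      unfolding g_def by (intro suminf_le hausdorff_measure_Un_le) auto
    also note m
    finally have "hausdorff_measure d (X - F) \<le> hausdorff_measure d Y + ennreal e"
      by (simp add: add_left_mono)
    then have "hausdorff_measure d (X \<inter> F) + hausdorff_measure d (X - F)
        \<le> hausdorff_measure d (X \<inter> F) + hausdorff_measure d Y + ennreal e"
      by (simp add: add.assoc add_left_mono)
    \<comment> \<open>\<open>Y\<close> keeps a positive distance from \<open>F\<close>, so metric
      additivity applies.\<close>
    also have "hausdorff_measure d (X \<inter> F) + hausdorff_measure d Y \<le> hausdorff_measure d ((X \<inter> F) \<union> Y)"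
    proof (rule hausdorff_measure_metric_additive)
      show "0 < 1 / (2 * real m + 1)" by simp
      fix x y assume "x \<in> X \<inter> F" "y \<in> Y"
      then have "1 / (2 * real m + 1) \<le> infdist y F" "infdist y F \<le> dist y x"
        by (auto simp: Y_def intro: infdist_le)
      then show "1 / (2 * real m + 1) \<le> dist x y" by (simp add: dist_commute)
    qed
    also have "\<dots> \<le> hausdorff_measure d X"
      by (rule hausdorff_measure_mono) (auto simp: Y_def)
    finally show "hausdorff_measure d (X \<inter> F) + hausdorff_measure d (X - F)
        \<le> hausdorff_measure d X + ennreal e"
      by (simp add: add_right_mono)
  qed
qed auto

section \<open>Hausdorff measure as a measure on the Borel sets\<close>

definition hausdorff :: "nat \<Rightarrow> 'a::metric_space measure" where
  "hausdorff d = measure_of UNIV (sets borel) (hausdorff_measure d)"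

lemma sets_hausdorff [simp, measurable_cong]: "sets (hausdorff d) = sets borel"
  and space_hausdorff [simp]: "space (hausdorff d) = UNIV"
  using sets.sigma_sets_eq[of borel] by (simp_all add: hausdorff_def)

text \<open>By Caratheodory the outer measure is a measure on its lambda system, which contains the
  closed sets by the splitting above and hence all Borel sets. Thus \<open>measure_of\<close> does
  not fall back on its default, the zero measure.\<close>

lemma emeasure_hausdorff:
  fixes A :: "'a::metric_space set"
  assumes "A \<in> sets borel"
  shows "emeasure (hausdorff d) A = hausdorff_measure d A"
proof -
  let ?H = "hausdorff_measure d :: 'a set \<Rightarrow> ennreal"
  let ?L = "lambda_system UNIV UNIV ?H"
  interpret P: sigma_algebra UNIV "UNIV :: 'a set set"
    using sigma_algebra_Pow[of UNIV] by simp
  have L: "measure_space UNIV ?L ?H"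
    by (rule P.caratheodory_lemma[OF outer_measure_space_hausdorff])
  then interpret L: sigma_algebra UNIV ?L by (simp add: measure_space_def)
  have "F \<in> ?L" if "closed F" for F
  proof -
    have "?H X \<le> ?H (X \<inter> F) + ?H (X - F)" for X
      using hausdorff_measure_Un_le[of d "X \<inter> F" "X - F"] by (simp add: Int_Diff_Un)
    then show ?thesis
      using hausdorff_measure_closed_split[OF that]
      by (auto simp: P.lambda_system_eq intro: antisym)
  qed
  then have "sets borel \<subseteq> ?L"
    unfolding borel_eq_closed by (auto intro!: L.sigma_sets_subset simp: sets_measure_of)
  moreover have "sigma_algebra UNIV (sets (borel :: 'a measure))"
    using sets.sigma_algebra_axioms[of borel] by simp
  ultimately show ?thesis
    unfolding hausdorff_def
    using L assms
    by (intro emeasure_measure_of_sigma)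
       (auto simp: measure_space_def positive_def countably_additive_def subset_iff)
qed

section \<open>Finite measure of Lipschitz images of balls in a subspace\<close>

lemma norm_le_sum_orthonormal:
  assumes "pairwise orthogonal B" "\<And>b. b \<in> B \<Longrightarrow> norm b = 1" "finite B" "v \<in> span B"
  shows "norm v \<le> (\<Sum>b\<in>B. \<bar>v \<bullet> b\<bar>)"
proof -
  have bb: "b \<bullet> c = (if b = c then 1 else 0)" if "b \<in> B" "c \<in> B" for b c
    using that assms(1,2) by (auto simp: pairwise_def orthogonal_def norm_eq_1)
  obtain u where u: "v = (\<Sum>b\<in>B. u b *\<^sub>R b)"
    using assms(3,4) by (auto simp: span_finite)
  have "v \<bullet> c = u c" if "c \<in> B" for c
    using that by (simp add: u inner_sum_left bb if_distrib[of "(*) _"] assms(3) cong: if_cong)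
  then have "v = (\<Sum>b\<in>B. (v \<bullet> b) *\<^sub>R b)" using u by simp
  then have "norm v \<le> (\<Sum>b\<in>B. norm ((v \<bullet> b) *\<^sub>R b))" by (metis norm_sum)
  then show ?thesis using assms(2) by simp
qed

text \<open>Grid argument: in orthonormal coordinates at most \<open>(2 * N + 1) ^ d\<close> cells
  of side \<open>r / N\<close> meet the ball, and their images have diameter of order
  \<open>1 / N\<close>. The powers of \<open>N\<close> cancel, so the bound does not depend on
  \<open>\<delta>\<close>.\<close>

lemma hausdorff_measure_Lipschitz_image_finite:
  fixes S :: "'a::euclidean_space set" and f :: "'a \<Rightarrow> 'b::real_normed_vector"
  assumes "subspace S" "dim S = d" "0 < L" "0 < r"
    and Lip: "\<And>y z. y \<in> cball x r \<inter> S \<Longrightarrow> z \<in> cball x r \<inter> S \<Longrightarrow> norm (f y - f z) \<le> L * norm (y - z)"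
  shows "hausdorff_measure d (f ` (cball x r \<inter> S)) < top"
proof -
  obtain B where B: "B \<subseteq> S" "pairwise orthogonal B" "\<And>b. b \<in> B \<Longrightarrow> norm b = 1"
      "independent B" "card B = dim S" "span B = S"
    using orthonormal_basis_subspace[OF assms(1)] by metis
  have finB: "finite B" using B(4) by (rule independent_imp_finite)
  \<comment> \<open>A cell has side \<open>r / N\<close>, hence diameter at most
    \<open>d * r / N\<close>, and its image has diameter at most \<open>K / N\<close>.\<close>
  define K where "K = L * real d * r"
  have "0 \<le> K" using assms by (simp add: K_def)
  have "hausdorff_measure d (f ` (cball x r \<inter> S))
      \<le> ennreal (unit_ball_vol (real d) * (3 * K / 2) ^ d)"
  proof (rule hausdorff_measure_least)
    fix \<delta> :: real assume "0 < \<delta>"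
    obtain N0 :: nat where N0: "K / \<delta> < real N0" using reals_Archimedean2 by blast
    define N where "N = Suc N0"
    have N: "0 < real N" "K / real N \<le> \<delta>" "1 \<le> real N"
      using N0 \<open>0 < \<delta>\<close> by (auto simp: N_def field_simps)
    \<comment> \<open>The grid index of \<open>s\<close> in direction \<open>b\<close>; on the ball
      it runs from \<open>- N\<close> to \<open>N\<close>, both included.\<close>
    define \<kappa> where "\<kappa> s b = \<lfloor>real N * ((s - x) \<bullet> b) / r\<rfloor>" for s b
    define cell where "cell k = {s \<in> cball x r \<inter> S. \<forall>b\<in>B. \<kappa> s b = k b}" for k
    \<comment> \<open>Indices are extensional functions on \<open>B\<close> so that there are
      finitely many; this is why \<open>\<kappa> s\<close> is restricted below.\<close>
    let ?I = "PiE B (\<lambda>_. {- int N..int N})"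
    have range: "\<kappa> s b \<in> {- int N..int N}" if "s \<in> cball x r \<inter> S" "b \<in> B" for s b
    proof -
      have "\<bar>(s - x) \<bullet> b\<bar> \<le> norm (s - x) * norm b" by (rule Cauchy_Schwarz_ineq2)
      also have "\<dots> \<le> r" using that B(3) by (simp add: dist_norm norm_minus_commute)
      finally have "\<bar>(s - x) \<bullet> b\<bar> / r \<le> 1" using \<open>0 < r\<close> by simp
      then have "real N * (\<bar>(s - x) \<bullet> b\<bar> / r) \<le> real N * 1" by (intro mult_left_mono) auto
      then have "\<bar>real N * ((s - x) \<bullet> b) / r\<bar> \<le> real N"
        using \<open>0 < r\<close> by (simp add: abs_mult abs_divide)
      then have "- real N \<le> real N * ((s - x) \<bullet> b) / r" "real N * ((s - x) \<bullet> b) / r < real N + 1"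
        unfolding abs_le_iff by linarith+
      then show ?thesis unfolding \<kappa>_def by (simp add: abs_le_iff le_floor_iff floor_le_iff del: abs_divide)
    qed
    have diam: "norm (s - t) \<le> real d * (r / real N)" if "s \<in> cell k" "t \<in> cell k" for s t k
    proof -
      have "\<bar>(s - t) \<bullet> b\<bar> \<le> r / real N" if "b \<in> B" for b
      proof -
        have "\<kappa> s b = \<kappa> t b" using \<open>s \<in> cell k\<close> \<open>t \<in> cell k\<close> that by (simp add: cell_def)
        then have "\<bar>real N * ((s - x) \<bullet> b) / r - real N * ((t - x) \<bullet> b) / r\<bar> \<le> 1"
          unfolding \<kappa>_def by linarith
        also have "real N * ((s - x) \<bullet> b) / r - real N * ((t - x) \<bullet> b) / r = real N * ((s - t) \<bullet> b) / r"
          by (simp add: inner_diff_left algebra_simps diff_divide_distrib)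
        finally show ?thesis using N(1) \<open>0 < r\<close> by (simp add: abs_mult abs_divide field_simps)
      qed
      then have "(\<Sum>b\<in>B. \<bar>(s - t) \<bullet> b\<bar>) \<le> real (card B) * (r / real N)"
        by (intro sum_bounded_above) auto
      moreover have "s - t \<in> span B"
        using that assms(1) B(6) by (auto simp: cell_def intro: subspace_diff)
      ultimately show ?thesis
        using norm_le_sum_orthonormal[OF B(2,3) finB] B(5) assms(2) by force
    qed
    have im: "norm (p - q) \<le> K / real N" if "p \<in> f ` cell k" "q \<in> f ` cell k" for p q k
    proof -
      from that obtain s t where st: "s \<in> cell k" "t \<in> cell k" "p = f s" "q = f t" by blast
      then have "norm (p - q) \<le> L * norm (s - t)" using Lip by (auto simp: cell_def)
      also have "\<dots> \<le> L * (real d * (r / real N))" using diam[OF st(1,2)] assms(3)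
        by (intro mult_left_mono) auto
      finally show ?thesis by (simp add: K_def mult.assoc)
    qed
    have bd: "bounded (f ` cell k)" "diameter (f ` cell k) \<le> K / real N" for k
    proof -
      show "bounded (f ` cell k)"
        using im[of _ k] by (auto simp: bounded_two_points dist_norm intro!: exI[of _ "K / real N"])
      show "diameter (f ` cell k) \<le> K / real N"
        using im[of _ k] \<open>0 \<le> K\<close> by (intro diameter_le) auto
    qed
    have "hausdorff_content d \<delta> (f ` (cball x r \<inter> S)) \<le> (\<Sum>k\<in>?I. hausdorff_weight d (f ` cell k))"
    proof (rule hausdorff_content_finite_cover)
      show "finite ?I" using finB by (intro finite_PiE) auto
      show "f ` (cball x r \<inter> S) \<subseteq> (\<Union>k\<in>?I. f ` cell k)"
      proof
        fix p assume "p \<in> f ` (cball x r \<inter> S)"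
        then obtain s where s: "s \<in> cball x r \<inter> S" "p = f s" by blast
        then have "restrict (\<kappa> s) B \<in> ?I" using range by auto
        moreover have "s \<in> cell (restrict (\<kappa> s) B)" using s by (simp add: cell_def)
        ultimately show "p \<in> (\<Union>k\<in>?I. f ` cell k)" using s(2) by blast
      qed
    qed (use \<open>0 < \<delta>\<close> bd N(2) in \<open>auto intro: order_trans\<close>)
    also have "\<dots> \<le> (\<Sum>k\<in>?I. ennreal (unit_ball_vol (real d) * (K / real N / 2) ^ d))"
      by (intro sum_mono hausdorff_weight_le bd)
    also have "\<dots> = ennreal (real (card ?I) * (unit_ball_vol (real d) * (K / real N / 2) ^ d))"
      using \<open>0 \<le> K\<close> by (simp add: ennreal_mult' ennreal_of_nat_eq_real_of_nat)
    also have "real (card ?I) = (2 * real N + 1) ^ d"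
      using finB B(5) assms(2) by (simp add: card_PiE nat_add_distrib add.commute)
    \<comment> \<open>Since \<open>N \<ge> 1\<close>, \<open>2 * N + 1 \<le> 3 * N\<close>, a
      multiple of \<open>N\<close> that cancels exactly.\<close>
    also have "ennreal ((2 * real N + 1) ^ d * (unit_ball_vol (real d) * (K / real N / 2) ^ d))
        \<le> ennreal ((3 * real N) ^ d * (unit_ball_vol (real d) * (K / real N / 2) ^ d))"
      using N(3) \<open>0 \<le> K\<close> by (intro ennreal_leI mult_right_mono power_mono) auto
    also have "(3 * real N) ^ d * (unit_ball_vol (real d) * (K / real N / 2) ^ d)
        = unit_ball_vol (real d) * (3 * K / 2) ^ d"
    proof -
      have "3 * real N * (K / real N / 2) = 3 * K / 2" using N(1) by simp
      then show ?thesis by (metis mult.left_commute power_mult_distrib)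
    qed
    finally show "hausdorff_content d \<delta> (f ` (cball x r \<inter> S))
        \<le> ennreal (unit_ball_vol (real d) * (3 * K / 2) ^ d)" .
  qed
  also have "\<dots> < top" by simp
  finally show ?thesis .
qed

subsection \<open>Points in general position\<close>

text \<open>\<open>G\<close> is extended to an affine basis of the whole space; \<open>m\<close> of
  the basis points, among them those of \<open>G\<close>, span the plane.\<close>

lemma affine_independent_subset_plane:
  fixes G :: "'a::euclidean_space set"
  assumes "\<not> affine_dependent G" "card G \<le> m" "1 \<le> m" "m \<le> DIM('a) + 1"
  obtains P where "affine P" "aff_dim P = int m - 1" "affine hull G \<subseteq> P"
proof -
  obtain T where T: "\<not> affine_dependent T" "G \<subseteq> T" "affine hull T = (UNIV :: 'a set)"
  proof (cases "G = {}")
    case True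
    then show ?thesis
      using extend_to_affine_basis_nonempty[of "{0 :: 'a}" UNIV] that by auto
  next
    case False
    then show ?thesis
      using extend_to_affine_basis_nonempty[of G UNIV] assms(1) that by auto
  qed
  have "aff_dim T = int DIM('a)" using T(3) by (metis aff_dim_UNIV aff_dim_affine_hull)
  then have "card T = DIM('a) + 1" using aff_dim_affine_independent[OF T(1)] by simp
  then obtain G' where G': "G \<subseteq> G'" "G' \<subseteq> T" "card G' = m"
    using exists_subset_between[OF assms(2) _ T(2)] assms(4) aff_independent_finite[OF T(1)] by auto
  have "\<not> affine_dependent G'" using affine_independent_subset T(1) G'(2) by blast
  then have "aff_dim (affine hull G') = int m - 1"
    using aff_dim_affine_independent[of G'] G'(3) by simp
  then show ?thesis using that[of "affine hull G'"] hull_mono[OF G'(1)] by simp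
qed

text \<open>Greedy choice: the subsets of \<open>F\<close> with at most \<open>m\<close> points span
  finitely many flats, and a point of \<open>A\<close> off all of them can be added without losing
  general position.\<close>

lemma general_position_subset_or_finite_plane_cover:
  fixes A :: "'a::euclidean_space set"
  assumes m: "1 \<le> m" "m \<le> DIM('a)"
    and ncov: "\<nexists>\<P>. finite \<P> \<and> (\<forall>P\<in>\<P>. affine P \<and> aff_dim P = int m - 1) \<and> A \<subseteq> \<Union>\<P>"
  shows "\<exists>F\<subseteq>A. finite F \<and> card F = N \<and> (\<forall>G\<subseteq>F. card G \<le> m + 1 \<longrightarrow> \<not> affine_dependent G)"
proof (induction N)
  case 0
  then show ?case by (intro exI[of _ "{}"]) auto
next
  case (Suc N)
  then obtain F where F: "F \<subseteq> A" "finite F" "card F = N"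
    and gp: "\<And>G. G \<subseteq> F \<Longrightarrow> card G \<le> m + 1 \<Longrightarrow> \<not> affine_dependent G" by blast
  define \<G> where "\<G> = {G. G \<subseteq> F \<and> card G \<le> m}"
  \<comment> \<open>The hulls may have smaller dimension; enlarging them to dimension exactly
    \<open>m - 1\<close> makes \<open>ncov\<close> applicable.\<close>
  have "\<exists>P. affine P \<and> aff_dim P = int m - 1 \<and> affine hull G \<subseteq> P" if "G \<in> \<G>" for G
  proof -
    have "\<not> affine_dependent G" "card G \<le> m" using that gp by (auto simp: \<G>_def)
    then show ?thesis using affine_independent_subset_plane[of G m] m by (metis le_SucI Suc_eq_plus1)
  qed
  then obtain P where P: "\<And>G. G \<in> \<G> \<Longrightarrow> affine (P G) \<and> aff_dim (P G) = int m - 1 \<and> affine hull G \<subseteq> P G"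
    by metis
  have "finite \<G>" using F(2) by (simp add: \<G>_def)
  have "\<not> A \<subseteq> \<Union>(P ` \<G>)"
  proof
    assume "A \<subseteq> \<Union>(P ` \<G>)"
    moreover have "finite (P ` \<G>)" using \<open>finite \<G>\<close> by simp
    moreover have "\<forall>Q\<in>P ` \<G>. affine Q \<and> aff_dim Q = int m - 1" using P by simp
    ultimately show False using ncov by meson
  qed
  then obtain a where "a \<in> A" "a \<notin> \<Union>(P ` \<G>)" by (meson subsetI)
  then have a: "a \<in> A" "\<And>G. G \<in> \<G> \<Longrightarrow> a \<notin> affine hull G"
    using P by (simp, meson UN_I subsetD)
  have "a \<notin> F"
  proof
    assume "a \<in> F"
    then have "{a} \<in> \<G>" using m by (simp add: \<G>_def)
    then show False using a(2)[of "{a}"] by simp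
  qed
  \<comment> \<open>Without \<open>a\<close>, such a set is in \<open>\<G>\<close>, and
    \<open>a\<close> lies off its affine hull.\<close>
  have "\<not> affine_dependent G" if "G \<subseteq> insert a F" "card G \<le> m + 1" for G
  proof (cases "a \<in> G")
    case True
    have "finite G" using that(1) F(2) finite_subset by blast
    then have "card (G - {a}) \<le> m" using True that(2) by simp
    moreover have "G - {a} \<subseteq> F" using that(1) by auto
    ultimately have "\<not> affine_dependent (G - {a})" "a \<notin> affine hull (G - {a})"
      using gp a(2) by (auto simp: \<G>_def)
    then have "\<not> affine_dependent (insert a (G - {a}))" by (rule affine_independent_insert)
    then show ?thesis using True by (simp add: insert_absorb)
  next
    case False
    then show ?thesis using gp that by blast
  qed
  then show ?case
    using F a(1) \<open>a \<notin> F\<close> by (intro exI[of _ "insert a F"]) auto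
qed

text \<open>Almost every point lies in at most \<open>m\<close> of the sets \<open>E a\<close>,
  because \<open>m + 1\<close> of them meet in a null set. Integrating the sum of their indicators
  gives the bound.\<close>

lemma card_mult_le_of_null_intersections:
  fixes E :: "'i \<Rightarrow> 'b set"
  assumes "finite F" "K \<in> sets M"
    and E: "\<And>a. a \<in> F \<Longrightarrow> E a \<in> sets M" "\<And>a. a \<in> F \<Longrightarrow> E a \<subseteq> K" "\<And>a. a \<in> F \<Longrightarrow> \<epsilon> \<le> emeasure M (E a)"
    and null: "\<And>G. G \<subseteq> F \<Longrightarrow> card G = m + 1 \<Longrightarrow> emeasure M (\<Inter>a\<in>G. E a) = 0"
  shows "of_nat (card F) * \<epsilon> \<le> of_nat m * emeasure M K"
proof -
  let ?\<G> = "{G. G \<subseteq> F \<and> card G = m + 1}"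
  have "AE x in M. \<forall>G\<in>?\<G>. x \<notin> (\<Inter>a\<in>G. E a)"
  proof (rule AE_finite_allI)
    show "finite ?\<G>" using assms(1) by simp
    fix G assume G: "G \<in> ?\<G>"
    then have "finite G" "G \<noteq> {}" using assms(1) finite_subset by auto
    then have "(\<Inter>a\<in>G. E a) \<in> sets M" using E(1) G by (intro sets.finite_INT) auto
    then have "(\<Inter>a\<in>G. E a) \<in> null_sets M" using null G by auto
    then show "AE x in M. x \<notin> (\<Inter>a\<in>G. E a)" by (rule AE_not_in)
  qed
  then have ae: "AE x in M. (\<Sum>a\<in>F. indicator (E a) x) \<le> (of_nat m * indicator K x :: ennreal)"
  proof (rule AE_mp, intro AE_I2 impI)
    fix x assume x: "\<forall>G\<in>?\<G>. x \<notin> (\<Inter>a\<in>G. E a)"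
    let ?H = "{a \<in> F. x \<in> E a}"
    have "card ?H \<le> m"
    proof (rule ccontr)
      assume "\<not> card ?H \<le> m"
      then obtain G where "G \<subseteq> ?H" "card G = m + 1"
        using obtain_subset_with_card_n[of "m + 1" ?H] by (metis Suc_eq_plus1 not_less_eq_eq)
      then show False using x by auto
    qed
    moreover have "(\<Sum>a\<in>F. indicator (E a) x) = (of_nat (card ?H) :: ennreal)"
      using assms(1) by (simp add: indicator_def sum.If_cases Int_def)
    moreover have "?H = {}" if "x \<notin> K" using that E(2) by auto
    ultimately show "(\<Sum>a\<in>F. indicator (E a) x) \<le> (of_nat m * indicator K x :: ennreal)"
      by (cases "x \<in> K") auto
  qed
  have "of_nat (card F) * \<epsilon> = (\<Sum>a\<in>F. \<epsilon>)" by simp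
  also have "\<dots> \<le> (\<Sum>a\<in>F. emeasure M (E a))" by (intro sum_mono E)
  also have "\<dots> = (\<Sum>a\<in>F. \<integral>\<^sup>+x. indicator (E a) x \<partial>M)" using E(1) by simp
  also have "\<dots> = (\<integral>\<^sup>+x. (\<Sum>a\<in>F. indicator (E a) x) \<partial>M)"
    using E(1) by (intro nn_integral_sum[symmetric]) auto
  also have "\<dots> \<le> (\<integral>\<^sup>+x. of_nat m * indicator K x \<partial>M)" by (rule nn_integral_mono_AE[OF ae])
  also have "\<dots> = of_nat m * emeasure M K" using assms(2) by (simp add: nn_integral_cmult)
  finally show ?thesis .
qed

lemma finite_plane_cover_of_null_intersections:
  fixes A :: "'a::euclidean_space set" and E :: "'a \<Rightarrow> 'b set"
  assumes m: "1 \<le> m" "m \<le> DIM('a)"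
    and K: "K \<in> sets M" "emeasure M K < top"
    and E: "\<And>a. E a \<in> sets M" "\<And>a. E a \<subseteq> K"
    and null: "\<And>G. \<not> affine_dependent G \<Longrightarrow> card G = m + 1 \<Longrightarrow> emeasure M (\<Inter>a\<in>G. E a) = 0"
    and "0 < \<epsilon>" and A: "\<And>a. a \<in> A \<Longrightarrow> ennreal \<epsilon> \<le> emeasure M (E a)"
  shows "\<exists>\<P>. finite \<P> \<and> (\<forall>P\<in>\<P>. affine P \<and> aff_dim P = int m - 1) \<and> A \<subseteq> \<Union>\<P>"
proof (rule ccontr)
  assume ncov: "\<not> ?thesis"
  obtain k where k: "emeasure M K = ennreal k" "0 \<le> k" using K(2) by (cases "emeasure M K") auto
  \<comment> \<open>With this many centres in general position, the counting bound
    \<open>N * \<epsilon> \<le> m * k\<close> fails.\<close>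
  obtain N :: nat where N: "real m * k / \<epsilon> < real N" using reals_Archimedean2 by blast
  obtain F where F: "F \<subseteq> A" "finite F" "card F = N"
    and gp: "\<And>G. G \<subseteq> F \<Longrightarrow> card G \<le> m + 1 \<Longrightarrow> \<not> affine_dependent G"
    using general_position_subset_or_finite_plane_cover[OF m ncov, of N] by blast
  have "of_nat (card F) * ennreal \<epsilon> \<le> of_nat m * emeasure M K"
    by (rule card_mult_le_of_null_intersections[where E = E]) (use F E K A null gp in auto)
  then have "ennreal (real N * \<epsilon>) \<le> ennreal (real m * k)"
    using F(3) k \<open>0 < \<epsilon>\<close> by (simp add: ennreal_mult' ennreal_of_nat_eq_real_of_nat)
  then have "real N * \<epsilon> \<le> real m * k" using k(2) \<open>0 < \<epsilon>\<close> by (subst (asm) ennreal_le_iff) auto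
  with N \<open>0 < \<epsilon>\<close> show False by (simp add: field_simps)
qed

subsection \<open>Tangent vectors\<close>

text \<open>The great circle in the directions \<open>p - a\<close> and \<open>v\<close> is a curve
  in the sphere with velocity \<open>v\<close> at \<open>p\<close>.\<close>

lemma tangent_space_sphere:
  fixes a p v :: "'a::euclidean_space"
  assumes "v \<bullet> (p - a) = 0" "p \<noteq> a"
  shows "v \<in> tangent_space (sphere a (dist a p)) p"
proof -
  define \<rho> where "\<rho> = norm (p - a)"
  \<comment> \<open>\<open>c\<close> is the angular speed, chosen so that \<open>w\<close> has
    length \<open>\<rho>\<close>. For \<open>v = 0\<close> division by zero yields
    \<open>w = 0\<close> and the curve is constant.\<close>
  define c where "c = norm v / \<rho>"
  define w where "w = (1 / c) *\<^sub>R v"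
  have "\<rho> > 0" using assms(2) by (simp add: \<rho>_def)
  have v: "c *\<^sub>R w = v" using \<open>\<rho> > 0\<close> by (auto simp: w_def c_def)
  define \<gamma> where "\<gamma> t = a + (cos (c * t) *\<^sub>R (p - a) + sin (c * t) *\<^sub>R w)" for t
  define \<gamma>' where "\<gamma>' t = (- (c * sin (c * t))) *\<^sub>R (p - a) + (c * cos (c * t)) *\<^sub>R w" for t
  have der: "(\<gamma> has_vector_derivative \<gamma>' t) (at t)" for t
    unfolding \<gamma>_def \<gamma>'_def by (auto intro!: derivative_eq_intros simp: algebra_simps)
  have orth: "(p - a) \<bullet> w = 0" using assms(1) by (simp add: w_def inner_commute)
  have "norm (\<gamma> t - a) = \<rho>" for t
  proof (cases "v = 0")
    case True
    then show ?thesis by (simp add: \<gamma>_def \<rho>_def c_def)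
  next
    case False
    then have w: "w \<bullet> w = \<rho>\<^sup>2"
      using \<open>\<rho> > 0\<close> by (simp add: w_def c_def power2_eq_square flip: power2_norm_eq_inner)
    have "(norm (x *\<^sub>R (p - a) + y *\<^sub>R w))\<^sup>2 = x\<^sup>2 * ((p - a) \<bullet> (p - a)) + y\<^sup>2 * (w \<bullet> w)" for x y
      using orth orth[unfolded inner_commute[of "p - a"]]
      by (simp only: power2_norm_eq_inner inner_add_left inner_add_right inner_scaleR_left
          inner_scaleR_right) (simp add: power2_eq_square)
    from this[of "cos (c * t)" "sin (c * t)"]
    have "(norm (\<gamma> t - a))\<^sup>2 = (cos (c * t))\<^sup>2 * ((p - a) \<bullet> (p - a)) + (sin (c * t))\<^sup>2 * (w \<bullet> w)"
      by (simp add: \<gamma>_def)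
    also have "\<dots> = \<rho>\<^sup>2 * ((cos (c * t))\<^sup>2 + (sin (c * t))\<^sup>2)"
      unfolding w by (simp only: \<rho>_def power2_norm_eq_inner algebra_simps)
    also have "\<dots> = \<rho>\<^sup>2" by simp
    finally show ?thesis using \<open>\<rho> > 0\<close> by (simp add: power2_eq_iff_nonneg)
  qed
  then have "\<gamma> ` {-1<..<1} \<subseteq> sphere a (dist a p)"
    by (auto simp: dist_norm norm_minus_commute \<rho>_def)
  moreover have "\<gamma> C1_differentiable_on {-1<..<1}"
    unfolding C1_differentiable_on_def
    by (intro exI[of _ \<gamma>'] conjI ballI der) (auto simp: \<gamma>'_def intro!: continuous_intros)
  moreover have "\<gamma> 0 = p" by (simp add: \<gamma>_def)
  moreover have "(\<gamma> has_vector_derivative v) (at 0)" using der[of 0] by (simp add: \<gamma>'_def v)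
  ultimately show ?thesis
    unfolding tangent_space_def by (auto intro!: exI[of _ \<gamma>] exI[of _ 1])
qed

text \<open>The sphere contributes the hyperplane orthogonal to \<open>p - a\<close>. A tangent
  vector of \<open>M\<close> outside that hyperplane spans the whole space together with it, since
  its multiples are tangent too.\<close>

lemma not_transverse_sphere_imp_orthogonal:
  fixes M :: "'a::euclidean_space set"
  assumes "\<not> transverse_at (sphere a (dist a p)) M p"
    and T: "subspace T" "T \<subseteq> tangent_space M p" and "v \<in> T"
  shows "(a - p) \<bullet> v = 0"
proof (rule ccontr)
  assume nz: "(a - p) \<bullet> v \<noteq> 0"
  then have "p \<noteq> a" by auto
  have vpa: "v \<bullet> (p - a) \<noteq> 0" using nz by (simp add: inner_commute inner_diff_right)
  have "\<exists>y z. x = y + z \<and> y \<in> tangent_space (sphere a (dist a p)) p \<and> z \<in> tangent_space M p" for x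
  proof -
    \<comment> \<open>This multiple of \<open>v\<close> carries the whole component of
      \<open>x\<close> along \<open>p - a\<close>.\<close>
    define c where "c = (x \<bullet> (p - a)) / (v \<bullet> (p - a))"
    have "(x - c *\<^sub>R v) \<bullet> (p - a) = 0"
      using vpa unfolding c_def by (simp only: inner_diff_left inner_scaleR_left) simp
    then have "x - c *\<^sub>R v \<in> tangent_space (sphere a (dist a p)) p"
      using \<open>p \<noteq> a\<close> by (rule tangent_space_sphere)
    moreover have "c *\<^sub>R v \<in> tangent_space M p"
      using T \<open>v \<in> T\<close> subspace_scale by blast
    ultimately show ?thesis by (intro exI[of _ "x - c *\<^sub>R v"] exI[of _ "c *\<^sub>R v"]) simp
  qed
  then have "transverse_at (sphere a (dist a p)) M p"
    unfolding transverse_at_def by blast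
  with assms(1) show False ..
qed

text \<open>The curve is the image under \<open>\<psi>\<close> of a short segment through
  \<open>x\<close> in direction \<open>s\<close>, which stays in
  \<open>V \<inter> S\<close>.\<close>

lemma tangent_space_parametrisation:
  fixes \<psi> :: "'a::euclidean_space \<Rightarrow> 'a" and D :: "'a \<Rightarrow> 'a \<Rightarrow>\<^sub>L 'a"
  assumes "open V" "subspace S" "x \<in> V \<inter> S" "s \<in> S"
    and D: "\<And>y. y \<in> V \<Longrightarrow> (\<psi> has_derivative blinfun_apply (D y)) (at y)" "continuous_on V D"
    and "\<psi> ` (V \<inter> S) \<subseteq> M"
  shows "blinfun_apply (D x) s \<in> tangent_space M (\<psi> x)"
proof -
  obtain e where e: "0 < e" "ball x e \<subseteq> V" using assms(1,3) open_contains_ball by blast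
  \<comment> \<open>Keeps the segment inside the ball of radius \<open>e\<close>; the added 1 covers
    \<open>s = 0\<close>.\<close>
  define \<epsilon> where "\<epsilon> = e / (norm s + 1)"
  have "0 < \<epsilon>" using e(1) by (simp add: \<epsilon>_def add_nonneg_pos)
  have V: "x + t *\<^sub>R s \<in> V" if "t \<in> {-\<epsilon><..<\<epsilon>}" for t
  proof -
    have "\<bar>t\<bar> * norm s \<le> \<epsilon> * norm s" using that by (intro mult_right_mono) auto
    also have "\<dots> < \<epsilon> * (norm s + 1)" using \<open>0 < \<epsilon>\<close> by simp
    also have "\<dots> = e" unfolding \<epsilon>_def using norm_ge_zero[of s] by (simp add: add_nonneg_eq_0_iff)
    finally show ?thesis using e(2) by (auto simp: dist_norm subset_iff)
  qed
  define \<gamma> where "\<gamma> t = \<psi> (x + t *\<^sub>R s)" for t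
  define \<gamma>' where "\<gamma>' t = blinfun_apply (D (x + t *\<^sub>R s)) s" for t
  have der: "(\<gamma> has_vector_derivative \<gamma>' t) (at t)" if "t \<in> {-\<epsilon><..<\<epsilon>}" for t
  proof -
    have "((\<lambda>t. x + t *\<^sub>R s) has_derivative (\<lambda>h. h *\<^sub>R s)) (at t)"
      by (auto intro!: derivative_eq_intros)
    from has_derivative_compose[OF this D(1)[OF V[OF that]]]
    show ?thesis
      unfolding has_vector_derivative_def \<gamma>_def \<gamma>'_def by (simp add: blinfun.scaleR_right)
  qed
  have "continuous_on {-\<epsilon><..<\<epsilon>} \<gamma>'"
    unfolding \<gamma>'_def
    by (intro continuous_intros continuous_on_compose2[OF D(2)]) (use V in auto)
  then have "\<gamma> C1_differentiable_on {-\<epsilon><..<\<epsilon>}"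
    unfolding C1_differentiable_on_def using der by blast
  moreover have "\<gamma> ` {-\<epsilon><..<\<epsilon>} \<subseteq> M"
    using V assms(2,3,4,7) by (auto simp: \<gamma>_def subspace_add subspace_scale image_subset_iff)
  moreover have "(\<gamma> has_vector_derivative blinfun_apply (D x) s) (at 0)"
    using der[of 0] \<open>0 < \<epsilon>\<close> by (simp add: \<gamma>'_def)
  ultimately show ?thesis
    unfolding tangent_space_def using \<open>0 < \<epsilon>\<close> by (auto intro!: exI[of _ \<gamma>] exI[of _ \<epsilon>] simp: \<gamma>_def)
qed

subsection \<open>Patches of a submanifold\<close>

text \<open>\<open>\<psi>\<close> stands for the inverse of a slice chart, defined on an ambient
  ball; only its restriction to \<open>S\<close> parametrises the patch. The closed ball supplies
  the compactness behind closed critical sets and a bounded derivative.\<close>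

locale c1_patch =
  fixes S :: "'a::euclidean_space set" and \<psi> :: "'a \<Rightarrow> 'a" and D :: "'a \<Rightarrow> 'a \<Rightarrow>\<^sub>L 'a"
    and x0 :: 'a and r :: real
  assumes subspace_S: "subspace S" and r_pos: "0 < r"
    and deriv: "\<And>x. x \<in> cball x0 r \<Longrightarrow> (\<psi> has_derivative blinfun_apply (D x)) (at x)"
    and cont_D: "continuous_on (cball x0 r) D"
    and inj_D: "\<And>x. x \<in> cball x0 r \<Longrightarrow> inj (blinfun_apply (D x))"
    and inj_\<psi>: "inj_on \<psi> (cball x0 r)"
begin

text \<open>
  In the coordinates \<open>\<psi>\<close>, these are the points at which the squared distance to \<open>a\<close> has a
  critical point on the patch; equivalently \<open>a\<close> lies in the affine normal space there.
\<close>

definition crit :: "'a \<Rightarrow> 'a set" where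
  "crit a = {x \<in> cball x0 r \<inter> S. \<forall>s\<in>S. (a - \<psi> x) \<bullet> D x s = 0}"

lemma cont_\<psi>: "continuous_on (cball x0 r) \<psi>"
  by (intro continuous_at_imp_continuous_on ballI has_derivative_continuous[OF deriv])

lemma closed_patch_domain: "closed (cball x0 r \<inter> S)"
  by (intro closed_Int closed_cball closed_subspace subspace_S)

lemma compact_crit: "compact (crit a)"
proof -
  \<comment> \<open>\<open>0 \<in> S\<close> keeps the index set nonempty; an empty intersection
    would be the whole space.\<close>
  have "crit a = (\<Inter>s\<in>S. {x \<in> cball x0 r \<inter> S. (a - \<psi> x) \<bullet> D x s = 0})"
    using subspace_0[OF subspace_S] by (auto simp: crit_def)
  moreover have "closed {x \<in> cball x0 r \<inter> S. (a - \<psi> x) \<bullet> D x s = 0}" for s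
    by (intro continuous_closed_preimage_constant closed_patch_domain continuous_intros
        continuous_on_subset[OF cont_\<psi>] continuous_on_subset[OF cont_D]) auto
  ultimately have "closed (crit a)" by (simp add: closed_INT)
  moreover have "bounded (crit a)"
    by (rule bounded_subset[OF bounded_cball[of x0 r]]) (auto simp: crit_def)
  ultimately show ?thesis by (simp add: compact_eq_bounded_closed)
qed

lemma compact_\<psi>_image:
  assumes "C \<subseteq> cball x0 r" "compact C"
  shows "compact (\<psi> ` C)"
  by (intro compact_continuous_image continuous_on_subset[OF cont_\<psi>] assms)

text \<open>The derivative is bounded on the compact convex ball, so \<open>\<psi>\<close> is
  Lipschitz there by the mean value inequality.\<close>

lemma hausdorff_measure_patch_finite:
  "hausdorff_measure (dim S) (\<psi> ` (cball x0 r \<inter> S)) < top"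
proof -
  have "compact ((\<lambda>x. norm (D x)) ` cball x0 r)"
    by (intro compact_continuous_image continuous_intros cont_D) auto
  then have "bounded ((\<lambda>x. norm (D x)) ` cball x0 r)" by (rule compact_imp_bounded)
  then obtain L where L: "0 < L" "\<And>x. x \<in> cball x0 r \<Longrightarrow> norm (D x) \<le> L"
    by (auto simp: bounded_pos)
  have "norm (\<psi> y - \<psi> z) \<le> L * norm (y - z)" if "y \<in> cball x0 r" "z \<in> cball x0 r" for y z
    by (rule differentiable_bound[of "cball x0 r" \<psi> "\<lambda>x. blinfun_apply (D x)"])
      (use that deriv L(2) in \<open>auto simp: has_derivative_at_withinI norm_blinfun.rep_eq[symmetric]\<close>)
  then show ?thesis
    by (intro hausdorff_measure_Lipschitz_image_finite[OF subspace_S refl L(1) r_pos]) auto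
qed

text \<open>
  All centres of \<open>A\<close> lie in the affine normal space of every common critical point, and by the
  dimension count they span it. So the patch meets one fixed affine plane transversally at these
  points, which makes them isolated.
\<close>

lemma finite_Inter_crit:
  assumes A: "\<not> affine_dependent A" "card A = DIM('a) - dim S + 1"
  shows "finite (\<Inter>a\<in>A. crit a)"
proof -
  let ?X = "\<Inter>a\<in>A. crit a"
  obtain a0 where a0: "a0 \<in> A" using A(2) by (metis add_is_0 all_not_in_conv card.empty one_neq_zero)
  \<comment> \<open>The direction space of the affine hull of \<open>A\<close>, the same for all
    points \<open>x\<close>.\<close>
  define N where "N = span ((\<lambda>a. a - a0) ` A)"
  have "aff_dim A = int (DIM('a) - dim S)" using aff_dim_affine_independent[OF A(1)] A(2) by simp
  then have dimN: "dim N = DIM('a) - dim S"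
    using aff_dim_eq_dim_subtract[of a0 A] hull_inc[OF a0] by (simp add: N_def)
  have normal: "a0 - \<psi> x \<in> N \<and> (\<forall>u\<in>N. \<forall>s\<in>S. u \<bullet> D x s = 0)" if x: "x \<in> ?X" for x
  proof -
    have xB: "x \<in> cball x0 r" using x a0 by (auto simp: crit_def)
    have orth: "(a - \<psi> x) \<bullet> D x s = 0" if "a \<in> A" "s \<in> S" for a s
      using that x by (auto simp: crit_def)
    have lin: "linear (blinfun_apply (D x))"
      by (rule bounded_linear.linear[OF blinfun.bounded_linear_right])
    define T where "T = blinfun_apply (D x) ` S"
    \<comment> \<open>The normal space of the patch at \<open>x\<close>. It contains
      \<open>N\<close> and has the same dimension, so the two agree.\<close>
    define N' where "N' = {u \<in> UNIV. \<forall>t\<in>T. orthogonal t u}"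
    have "subspace T" unfolding T_def using lin subspace_S by (rule linear_subspace_image)
    then have "dim N' + dim T = DIM('a)"
      using dim_subspace_orthogonal_to_vectors[of T UNIV] by (simp add: N'_def)
    moreover have "dim T = dim S"
      unfolding T_def by (rule dim_image_eq[OF lin inj_on_subset[OF inj_D[OF xB] subset_UNIV]])
    ultimately have dimN': "dim N' = DIM('a) - dim S" by simp
    have N'_iff: "u \<in> N' \<longleftrightarrow> (\<forall>s\<in>S. u \<bullet> D x s = 0)" for u
      by (simp add: N'_def T_def orthogonal_def inner_commute)
    have subN': "subspace N'"
      unfolding subspace_def by (simp add: N'_iff inner_add_left)
    have mem: "a - \<psi> x \<in> N'" if "a \<in> A" for a
      using orth[OF that] by (simp add: N'_iff)
    have "a - a0 \<in> N'" if "a \<in> A" for a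
      using subspace_diff[OF subN' mem[OF that] mem[OF a0]] by simp
    then have "N \<subseteq> N'" unfolding N_def using subN' by (intro span_minimal) auto
    then have "N = N'"
      using dimN dimN' subN' by (intro subspace_dim_equal) (simp_all add: N_def)
    then show ?thesis using mem[OF a0] N'_iff by simp
  qed
  have "\<not> x islimpt ?X" if x: "x \<in> ?X" for x
  proof
    assume lim: "x islimpt ?X"
    have xB: "x \<in> cball x0 r" "x \<in> S" using x a0 by (auto simp: crit_def)
    obtain c where c: "0 < c" "\<And>s. c * norm s \<le> norm (D x s)"
      using linear_inj_bounded_below_pos[OF
          bounded_linear.linear[OF blinfun.bounded_linear_right] inj_D[OF xB(1)]] by blast
    \<comment> \<open>The linearisation error is kept to half the lower bound for
      \<open>D x (y - x)\<close>, so \<open>\<psi> y - \<psi> x\<close> cannot be orthogonal to that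
      vector.\<close>
    have "\<exists>\<delta>>0. \<forall>y. norm (y - x) < \<delta> \<longrightarrow> norm (\<psi> y - \<psi> x - D x (y - x)) \<le> c / 2 * norm (y - x)"
      using conjunct2[OF iffD1[OF has_derivative_at_alt deriv[OF xB(1)]], rule_format, of "c / 2"] c(1)
      by simp
    then obtain \<delta> where \<delta>: "0 < \<delta>"
      "\<And>y. norm (y - x) < \<delta> \<Longrightarrow> norm (\<psi> y - \<psi> x - D x (y - x)) \<le> c / 2 * norm (y - x)"
      by auto
    obtain y where y: "y \<in> ?X" "y \<noteq> x" "norm (y - x) < \<delta>"
      using lim[unfolded islimpt_approachable, rule_format, OF \<delta>(1)] by (auto simp only: dist_norm)
    have "y \<in> S" using y(1) a0 by (auto simp: crit_def)
    define w where "w = D x (y - x)"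
    \<comment> \<open>Both image points lie in the one plane through \<open>a0\<close> with
      direction \<open>N\<close>, which is orthogonal to the tangent vector
      \<open>w\<close>.\<close>
    have "(a0 - \<psi> x) - (a0 - \<psi> y) \<in> N"
      unfolding N_def
      by (rule span_diff) (use normal[OF x] normal[OF y(1)] in \<open>simp_all add: N_def\<close>)
    then have "\<psi> y - \<psi> x \<in> N" by simp
    then have uw: "(\<psi> y - \<psi> x) \<bullet> w = 0"
      using normal[OF x] subspace_diff[OF subspace_S \<open>y \<in> S\<close> xB(2)] unfolding w_def by blast
    have "norm w * norm w = w \<bullet> (w - (\<psi> y - \<psi> x))"
      using uw unfolding inner_diff_right[of w w "\<psi> y - \<psi> x"] inner_commute[of w "\<psi> y - \<psi> x"]
      by (simp add: dot_square_norm power2_eq_square)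
    also have "\<dots> \<le> norm w * norm (w - (\<psi> y - \<psi> x))" by (rule norm_cauchy_schwarz)
    also have "\<dots> \<le> norm w * (c / 2 * norm (y - x))"
      using \<delta>(2)[OF y(3)] by (intro mult_left_mono norm_ge_zero) (simp only: w_def norm_minus_commute)
    finally have "norm w * norm w \<le> norm w * (c / 2 * norm (y - x))" .
    moreover have pos: "0 < c * norm (y - x)" using c(1) y(2) by simp
    moreover have le: "c * norm (y - x) \<le> norm w" using c(2) by (simp add: w_def)
    moreover have "0 < norm w" using pos le by linarith
    ultimately have "norm w \<le> c / 2 * norm (y - x)" by (simp only: mult_le_cancel_left_pos)
    with le pos show False by simp
  qed
  moreover have "compact ?X" using a0 compact_crit by (intro compact_Inter) auto
  ultimately show ?thesis using finite_not_islimpt_in_compact[of ?X ?X] by simp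
qed

lemma finite_plane_cover_of_large_crit:
  assumes "1 \<le> dim S" "dim S < DIM('a)" "0 < \<epsilon>"
  shows "\<exists>\<P>. finite \<P> \<and> (\<forall>P\<in>\<P>. affine P \<and> aff_dim P = int DIM('a) - int (dim S) - 1) \<and>
    {a. ennreal \<epsilon> \<le> hausdorff_measure (dim S) (\<psi> ` crit a)} \<subseteq> \<Union>\<P>"
proof -
  let ?m = "DIM('a) - dim S"
  let ?M = "hausdorff (dim S) :: 'a measure"
  let ?K = "\<psi> ` (cball x0 r \<inter> S)"
  have meas: "\<psi> ` crit a \<in> sets borel" for a
    by (rule borel_compact[OF compact_\<psi>_image[OF _ compact_crit]]) (auto simp: crit_def)
  have "compact ?K"
    by (intro compact_\<psi>_image compact_Int_closed compact_cball closed_subspace subspace_S) auto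
  then have K: "?K \<in> sets borel" by (rule borel_compact)
  \<comment> \<open>Injectivity of \<open>\<psi>\<close> turns the intersection of the images into
    the image of a finite set.\<close>
  have "emeasure ?M (\<Inter>a\<in>G. \<psi> ` crit a) = 0" if G: "\<not> affine_dependent G" "card G = ?m + 1" for G
  proof -
    have "G \<noteq> {}" using G(2) by auto
    then obtain g where "g \<in> G" by blast
    have "(\<Inter>a\<in>G. \<psi> ` crit a) = \<psi> ` (\<Inter>a\<in>G. crit a)"
      by (rule image_INT[OF inj_\<psi> _ \<open>g \<in> G\<close>, symmetric]) (auto simp: crit_def)
    then have fin: "finite (\<Inter>a\<in>G. \<psi> ` crit a)" using finite_Inter_crit[OF G] by simp
    then have "(\<Inter>a\<in>G. \<psi> ` crit a) \<in> sets borel" by (intro borel_closed finite_imp_closed)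
    then show ?thesis
      using hausdorff_measure_finite_null[OF fin assms(1)] by (simp add: emeasure_hausdorff)
  qed
  then have "\<exists>\<P>. finite \<P> \<and> (\<forall>P\<in>\<P>. affine P \<and> aff_dim P = int ?m - 1) \<and>
    {a. ennreal \<epsilon> \<le> hausdorff_measure (dim S) (\<psi> ` crit a)} \<subseteq> \<Union>\<P>"
    using assms K meas hausdorff_measure_patch_finite
    by (intro finite_plane_cover_of_null_intersections
        [where M = ?M and K = ?K and E = "\<lambda>a. \<psi> ` crit a" and \<epsilon> = \<epsilon>])
      (auto simp: emeasure_hausdorff, auto simp: crit_def)
  then show ?thesis using assms(2) by (simp add: of_nat_diff)
qed

end

text \<open>Nontransversality at \<open>q\<close> forces \<open>a - q\<close> to be orthogonal to
  the tangent vectors supplied by the chart, which makes \<open>\<Phi> q\<close> critical. The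
  inclusion passes from the nontransverse set to a compact, hence measurable, one.\<close>

lemma C1_submanifold_patch:
  fixes M :: "'a::euclidean_space set"
  assumes "C1_submanifold d M" "p \<in> M"
  shows "\<exists>W S \<psi> D x0 r. open W \<and> p \<in> W \<and> c1_patch S \<psi> D x0 r \<and> dim S = d \<and>
    (\<forall>a. W \<inter> nontransverse_points M a \<subseteq> \<psi> ` c1_patch.crit S \<psi> D x0 r a)"
proof -
  from assms(1)[unfolded C1_submanifold_def, rule_format, OF assms(2)]
  obtain U and V :: "'a set" and \<Phi> \<psi> S where UV: "open U" "p \<in> U" "open V" and hom: "homeomorphism U V \<Phi> \<psi>"
    and "C1_map_on U \<Phi>" "C1_map_on V \<psi>" and S: "subspace S" "dim S = d" and im: "\<Phi> ` (U \<inter> M) = V \<inter> S"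
    by (elim exE conjE) (rule that; assumption)
  then obtain D' D where D': "\<And>x. x \<in> U \<Longrightarrow> (\<Phi> has_derivative blinfun_apply (D' x)) (at x)"
    and D: "\<And>x. x \<in> V \<Longrightarrow> (\<psi> has_derivative blinfun_apply (D x)) (at x)" "continuous_on V D"
    unfolding C1_map_on_def by blast
  have inv: "\<psi> (\<Phi> x) = x" if "x \<in> U" for x using hom that by (simp add: homeomorphism_def)
  have inv': "\<psi> y \<in> U" "\<Phi> (\<psi> y) = y" if "y \<in> V" for y
    using hom that by (auto simp: homeomorphism_def)
  have "\<Phi> p \<in> V" using hom UV(2) by (auto simp: homeomorphism_def)
  then obtain r where r: "0 < r" "cball (\<Phi> p) r \<subseteq> V"
    using UV(3) open_contains_cball by blast
  \<comment> \<open>The chain rule for \<open>\<Phi> \<circ> \<psi> = id\<close> gives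
    \<open>D y\<close> a left inverse.\<close>
  have inj: "inj (blinfun_apply (D y))" if "y \<in> V" for y
  proof -
    have "(\<Phi> \<circ> \<psi> has_derivative blinfun_apply (D' (\<psi> y)) \<circ> blinfun_apply (D y)) (at y)"
      using D(1) D' inv'(1) that by (intro diff_chain_at) auto
    moreover have "(\<Phi> \<circ> \<psi> has_derivative id) (at y)"
      by (rule has_derivative_transform_within_open[OF has_derivative_id[unfolded id_def[symmetric]] UV(3) that])
        (simp add: inv')
    ultimately have "blinfun_apply (D' (\<psi> y)) \<circ> blinfun_apply (D y) = id"
      by (rule has_derivative_unique)
    then show ?thesis by (metis inj_on_id inj_on_imageI2)
  qed
  have patch: "c1_patch S \<psi> D (\<Phi> p) r"
  proof
    show "inj_on \<psi> (cball (\<Phi> p) r)"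
      using inv'(2) r(2) by (metis inj_on_inverseI subsetD)
    show "continuous_on (cball (\<Phi> p) r) D"
      using D(2) r(2) by (rule continuous_on_subset)
  qed (use S r D(1) inj in \<open>auto simp: subset_iff\<close>)
  define W where "W = U \<inter> \<Phi> -` ball (\<Phi> p) r"
  have "open W" unfolding W_def
    using hom UV(1) by (intro continuous_open_preimage) (auto simp: homeomorphism_def)
  moreover have "p \<in> W" using UV(2) r(1) by (simp add: W_def)
  moreover have "W \<inter> nontransverse_points M a \<subseteq> \<psi> ` c1_patch.crit S \<psi> D (\<Phi> p) r a" for a
  proof
    fix q assume "q \<in> W \<inter> nontransverse_points M a"
    then have q: "q \<in> U" "\<Phi> q \<in> cball (\<Phi> p) r" "q \<in> M" and
      nt: "\<not> transverse_at (sphere a (dist a q)) M q"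
      by (auto simp: W_def nontransverse_points_def)
    have qVS: "\<Phi> q \<in> V \<inter> S" using im q by blast
    have sub: "\<psi> ` (V \<inter> S) \<subseteq> M" unfolding im[symmetric] using inv by auto
    have "blinfun_apply (D (\<Phi> q)) ` S \<subseteq> tangent_space M q"
      using tangent_space_parametrisation[OF UV(3) S(1) qVS _ D sub] inv[OF q(1)] by auto
    moreover have "subspace (blinfun_apply (D (\<Phi> q)) ` S)"
      using S(1)
      by (intro linear_subspace_image bounded_linear.linear[OF blinfun.bounded_linear_right])
    ultimately have "(a - q) \<bullet> D (\<Phi> q) s = 0" if "s \<in> S" for s
      using not_transverse_sphere_imp_orthogonal[OF nt] that by blast
    then have "\<Phi> q \<in> c1_patch.crit S \<psi> D (\<Phi> p) r a"
      using q(2) qVS inv[OF q(1)] by (simp add: c1_patch.crit_def[OF patch])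
    then show "q \<in> \<psi> ` c1_patch.crit S \<psi> D (\<Phi> p) r a"
      using inv[OF q(1)] by (metis imageI)
  qed
  ultimately show ?thesis using patch S(2) by blast
qed

text \<open>By Lindelof countably many patches cover \<open>M\<close>. For an exceptional centre
  some patch carries a nonnull critical image, whose measure is at least \<open>1 / (k + 1)\<close>
  for some \<open>k\<close>; each pair of patch and \<open>k\<close> costs finitely many
  planes.\<close>

lemma exceptional_centres_countable_plane_cover:
  fixes M :: "'a::euclidean_space set"
  assumes "1 \<le> d" "d < DIM('a)" "C1_submanifold d M"
  shows "\<exists>\<P>. countable \<P> \<and> (\<forall>P\<in>\<P>. affine P \<and> aff_dim P = int DIM('a) - int d - 1) \<and>
    exceptional_centres d M \<subseteq> \<Union>\<P>"
proof -
  define planes where "planes \<P> \<longleftrightarrow> finite \<P> \<and>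
    (\<forall>P\<in>\<P>. affine P \<and> aff_dim P = int DIM('a) - int d - 1)" for \<P> :: "'a set set"
  \<comment> \<open>Hides the chart data, so that only \<open>W\<close> and \<open>E\<close> have to
    be chosen for each point.\<close>
  define local where "local p W E \<longleftrightarrow> open W \<and> p \<in> W \<and>
      (\<forall>a. W \<inter> nontransverse_points M a \<subseteq> E a) \<and>
      (\<forall>k. \<exists>\<P>. planes \<P> \<and> {a. ennreal (1 / real (Suc k)) \<le> hausdorff_measure d (E a)} \<subseteq> \<Union>\<P>)"
    for p W and E :: "'a \<Rightarrow> 'a set"
  have "\<exists>W E. local p W E" if "p \<in> M" for p
  proof -
    obtain W S \<psi> D x0 r where *: "open W" "p \<in> W" "c1_patch S \<psi> D x0 r" "dim S = d"
        "\<forall>a. W \<inter> nontransverse_points M a \<subseteq> \<psi> ` c1_patch.crit S \<psi> D x0 r a"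
      using C1_submanifold_patch[OF assms(3) \<open>p \<in> M\<close>] by (elim exE conjE) (rule that; assumption)
    have "\<exists>\<P>. planes \<P> \<and> {a. ennreal (1 / real (Suc k))
        \<le> hausdorff_measure d (\<psi> ` c1_patch.crit S \<psi> D x0 r a)} \<subseteq> \<Union>\<P>" for k
      using c1_patch.finite_plane_cover_of_large_crit[OF *(3), of "1 / real (Suc k)"] assms(1,2)
      unfolding planes_def *(4) conj_assoc by simp
    then have "local p W (\<lambda>a. \<psi> ` c1_patch.crit S \<psi> D x0 r a)"
      unfolding local_def using *(1,2,5) by simp
    then show ?thesis by blast
  qed
  then obtain W E where WE: "\<And>p. p \<in> M \<Longrightarrow> local p (W p) (E p)" by metis
  have W: "open (W p)" "p \<in> W p" and E: "W p \<inter> nontransverse_points M a \<subseteq> E p a"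
    and cov: "\<exists>\<P>. planes \<P> \<and> {a. ennreal (1 / real (Suc k)) \<le> hausdorff_measure d (E p a)} \<subseteq> \<Union>\<P>"
    if "p \<in> M" for p a k
    using WE[OF that] unfolding local_def by simp_all
  define \<P> where "\<P> p k = (SOME \<P>. planes \<P> \<and>
    {a. ennreal (1 / real (Suc k)) \<le> hausdorff_measure d (E p a)} \<subseteq> \<Union>\<P>)" for p k
  have \<P>: "planes (\<P> p k)"
    "{a. ennreal (1 / real (Suc k)) \<le> hausdorff_measure d (E p a)} \<subseteq> \<Union>(\<P> p k)"
    if "p \<in> M" for p k
    using someI_ex[OF cov[OF that, of k]] unfolding \<P>_def by simp_all
  obtain \<W> where \<W>: "\<W> \<subseteq> W ` M" "countable \<W>" "\<Union>\<W> = \<Union>(W ` M)"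
    using Lindelof[of "W ` M"] W(1) by blast
  obtain I where I: "I \<subseteq> M" "countable I" "\<W> = W ` I"
    using countable_subset_image[of \<W> W M] \<W> by auto
  have cover: "M \<subseteq> (\<Union>p\<in>I. W p)" using W(2) \<W>(3) I(3) by auto
  show ?thesis
  proof (intro exI[of _ "\<Union>p\<in>I. \<Union>k. \<P> p k"] conjI)
    show "countable (\<Union>p\<in>I. \<Union>k. \<P> p k)"
      by (intro countable_UN[OF I(2)] countable_UN[OF countableI_type] countable_finite)
        (use I(1) \<P>(1) in \<open>auto simp: planes_def\<close>)
    show "\<forall>P\<in>\<Union>p\<in>I. \<Union>k. \<P> p k. affine P \<and> aff_dim P = int DIM('a) - int d - 1"
      using I(1) \<P>(1) unfolding planes_def by blast
    show "exceptional_centres d M \<subseteq> \<Union>(\<Union>p\<in>I. \<Union>k. \<P> p k)"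
    proof
      fix a assume "a \<in> exceptional_centres d M"
      then have pos: "hausdorff_measure d (nontransverse_points M a) \<noteq> 0"
        by (simp add: exceptional_centres_def)
      have "nontransverse_points M a \<subseteq> (\<Union>p\<in>I. E p a)"
      proof
        fix q assume q: "q \<in> nontransverse_points M a"
        then have "q \<in> M" by (simp add: nontransverse_points_def)
        then obtain p where "p \<in> I" "q \<in> W p" using cover by blast
        then show "q \<in> (\<Union>p\<in>I. E p a)" using E[of p a] I(1) q by blast
      qed
      then have "hausdorff_measure d (\<Union>p\<in>I. E p a) \<noteq> 0"
        using pos hausdorff_measure_mono[of _ _ d] by (metis le_zero_eq)
      \<comment> \<open>Countability of \<open>I\<close> enters here: countably many null sets would
        have a null union.\<close>
      then obtain p where p: "p \<in> I" "hausdorff_measure d (E p a) \<noteq> 0"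
        using hausdorff_measure_countable_UN_null[OF I(2), of d "\<lambda>p. E p a"] by blast
      have "\<exists>k. ennreal (1 / real (Suc k)) \<le> hausdorff_measure d (E p a)"
      proof (cases "hausdorff_measure d (E p a)")
        case (real x)
        with p(2) have "0 < x" by (metis ennreal_0 order_le_less)
        then obtain k where "1 / real (Suc k) < x"
          using reals_Archimedean by (metis inverse_eq_divide)
        then show ?thesis using real by (intro exI[of _ k]) (simp add: ennreal_leI)
      qed auto
      then obtain k where "a \<in> \<Union>(\<P> p k)" using \<P>(2)[of p] I(1) p(1) by blast
      then show "a \<in> \<Union>(\<Union>p\<in>I. \<Union>k. \<P> p k)" using p(1) by blast
    qed
  qed
qed

theorem theorem1p1:
  fixes \<Sigma> :: "(real ^ 'n) set" and d :: nat
  assumes "d \<ge> 1" and "CARD('n) \<ge> d + 1"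
    and "C1_submanifold d \<Sigma>"
  shows "\<exists>\<P> :: (real ^ 'n) set set. countable \<P> \<and>
           (\<forall>P\<in>\<P>. affine P \<and> aff_dim P = int CARD('n) - int d - 1) \<and>
           exceptional_centres d \<Sigma> \<subseteq> \<Union>\<P>"
  using exceptional_centres_countable_plane_cover[of d \<Sigma>] assms by simp

end
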